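(* There exist an absolute constant $c\ge1$ and, for each $\alpha\ge2$, a constant $K_\alpha>0$ depending only on $\alpha$, such that the following holds. Let $\alpha\ge2$ and $K\ge K_\alpha$. Then there exists a constant $c'>0$ depending only on $\alpha$ and $K$ such that for all integers $n\ge2$, $p\ge1$ and $s\in[p]$ with $s\ge c$, $$\mathcal{R}_{\mathcal{P}}(\rho)\ge\frac12\quad\text{whenever}\quad\rho^2\le c'\,v_{\mathcal{P}}^{\mathrm L},$$ where $$v_{\mathcal{P}}^{\mathrm L}:=\Bigl\{s(p/s)^{2/\alpha}\wedge\bigl[p^{(2/\alpha)\vee(1/2)}(\log\log(8n))^{\omega_2}\bigr]\Bigr\}+\log\log(8n)$$ and $\omega_2=\frac12$ if both $s>\sqrt{p\log\log(8n)}$ and $\alpha\ge4$, and $\omega_2=0$ otherwise.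
   Context: Notation: $[m]=\{1,\dots,m\}$; $x\wedge y=\min(x,y)$, $x\vee y=\max(x,y)$; $\log$ is the natural logarithm; $\|v\|_0$ is the number of nonzero entries of $v$. Model: $X=\theta+E\in\mathbb{R}^{p\times n}$, with deterministic $\theta$ and random $E\sim P_e$; $X_t,\theta_t,E_t\in\mathbb{R}^p$ denote the $t$-th columns. $\mathbb{E}_{\theta,P_e}$ is expectation under the law of $X$. Null space: $\Theta_0(p,n)=\{\theta:\exists\mu\in\mathbb{R}^p,\ \theta_t=\mu\ \forall t\in[n]\}$. For $t_0\in[n-1]$, $\Theta^{(t_0)}(p,n,s,\rho)$ is the set of $\theta$ for which there are $\mu_1,\mu_2\in\mathbb{R}^p$ with $\theta_t=\mu_1$ for $t\le t_0$, $\theta_t=\mu_2$ for $t>t_0$, $\|\mu_1-\mu_2\|_0\le s$ and $\frac{t_0(n-t_0)}{n}\|\mu_1-\mu_2\|_2^2\ge\rho^2$. Alternative space: $\Theta(p,n,s,\rho)=\bigcup_{t_0=1}^{n-1}\Theta^{(t_0)}(p,n,s,\rho)$. Noise class: $\mathcal{P}_{\alpha,K}$ is the class of distributions of real random variables $W$ with $\mathbb{E}W=0$, $\mathbb{E}W^2=1$, $\mathbb{E}|W/K|^\alpha\le1$. $\mathcal{P}_{\alpha,K}^{\otimes}$ is the class of joint distributions of $E$ with mutually independent entries, each entry having a (possibly different) distribution in $\mathcal{P}_{\alpha,K}$. Minimax testing error, with the infimum over all measurable $\phi:\mathbb{R}^{p\times n}\to\{0,1\}$: $$\mathcal{R}_{\mathcal{P}}(\rho)=\inf_\phi\Bigl\{\sup_{P_e\in\mathcal{P}_{\alpha,K}^{\otimes}}\sup_{\theta\in\Theta_0(p,n)}\mathbb{E}_{\theta,P_e}(\phi)+\sup_{P_e\in\mathcal{P}_{\alpha,K}^{\otimes}}\sup_{\theta\in\Theta(p,n,s,\rho)}\mathbb{E}_{\theta,P_e}(1-\phi)\Bigr\}.$$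 *)

theory Defs
  imports "HOL-Probability.Probability"
begin

text \<open>
  A matrix in \<open>\<real>\<^sup>p\<^sup>\<times>\<^sup>n\<close> is an extensional function on the index set below; the pair \<open>(i, t)\<close>
  addresses row \<open>i\<close> of column \<open>t\<close>. A vector in \<open>\<real>\<^sup>p\<close> is a function of which only the values on
  \<open>{1..p}\<close> are ever used.
\<close>

definition matrix_index :: "nat \<Rightarrow> nat \<Rightarrow> (nat \<times> nat) set" where
  "matrix_index p n = {1..p} \<times> {1..n}"

definition matrix_space :: "nat \<Rightarrow> nat \<Rightarrow> (nat \<times> nat \<Rightarrow> real) measure" where
  "matrix_space p n = PiM (matrix_index p n) (\<lambda>_. borel)"

definition l0_norm :: "nat \<Rightarrow> (nat \<Rightarrow> real) \<Rightarrow> nat" where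
  "l0_norm p v = card {i \<in> {1..p}. v i \<noteq> 0}"

definition l2_norm :: "nat \<Rightarrow> (nat \<Rightarrow> real) \<Rightarrow> real" where
  "l2_norm p v = L2_set v {1..p}"

definition null_space :: "nat \<Rightarrow> nat \<Rightarrow> (nat \<times> nat \<Rightarrow> real) set" where
  "null_space p n =
     {\<theta> \<in> space (matrix_space p n). \<exists>\<mu>. \<forall>t\<in>{1..n}. \<forall>i\<in>{1..p}. \<theta> (i, t) = \<mu> i}"

definition alt_space_at ::
    "nat \<Rightarrow> nat \<Rightarrow> nat \<Rightarrow> nat \<Rightarrow> real \<Rightarrow> (nat \<times> nat \<Rightarrow> real) set" where
  "alt_space_at t0 p n s \<rho> =
     {\<theta> \<in> space (matrix_space p n). \<exists>\<mu>1 \<mu>2.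
        (\<forall>t\<in>{1..n}. \<forall>i\<in>{1..p}. \<theta> (i, t) = (if t \<le> t0 then \<mu>1 i else \<mu>2 i)) \<and>
        l0_norm p (\<lambda>i. \<mu>1 i - \<mu>2 i) \<le> s \<and>
        real t0 * (real n - real t0) / real n * (l2_norm p (\<lambda>i. \<mu>1 i - \<mu>2 i))\<^sup>2 \<ge> \<rho>\<^sup>2}"

definition alt_space :: "nat \<Rightarrow> nat \<Rightarrow> nat \<Rightarrow> real \<Rightarrow> (nat \<times> nat \<Rightarrow> real) set" where
  "alt_space p n s \<rho> = (\<Union>t0\<in>{1..n-1}. alt_space_at t0 p n s \<rho>)"

text \<open>
  The integrability clauses are essential: the Bochner integral of a non-integrable function is 0.
\<close>

definition noise_class :: "real \<Rightarrow> real \<Rightarrow> real measure set" where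
  "noise_class \<alpha> K =
     {D. prob_space D \<and> sets D = sets borel \<and>
         integrable D (\<lambda>w. w) \<and> (\<integral>w. w \<partial>D) = 0 \<and>
         integrable D (\<lambda>w. w\<^sup>2) \<and> (\<integral>w. w\<^sup>2 \<partial>D) = 1 \<and>
         integrable D (\<lambda>w. \<bar>w / K\<bar> powr \<alpha>) \<and> (\<integral>w. \<bar>w / K\<bar> powr \<alpha> \<partial>D) \<le> 1}"

definition joint_noise_class ::
    "real \<Rightarrow> real \<Rightarrow> nat \<Rightarrow> nat \<Rightarrow> (nat \<times> nat \<Rightarrow> real) measure set" where
  "joint_noise_class \<alpha> K p n =
     {P. prob_space P \<and> sets P = sets (matrix_space p n) \<and>
         prob_space.indep_vars P (\<lambda>_. borel) (\<lambda>j E. E j) (matrix_index p n) \<and>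
         (\<forall>j\<in>matrix_index p n. distr P borel (\<lambda>E. E j) \<in> noise_class \<alpha> K)}"

definition obs_law ::
    "nat \<Rightarrow> nat \<Rightarrow> (nat \<times> nat \<Rightarrow> real) \<Rightarrow> (nat \<times> nat \<Rightarrow> real) measure
       \<Rightarrow> (nat \<times> nat \<Rightarrow> real) measure" where
  "obs_law p n \<theta> P = distr P (matrix_space p n) (\<lambda>E. \<lambda>j\<in>matrix_index p n. \<theta> j + E j)"

definition tests :: "nat \<Rightarrow> nat \<Rightarrow> ((nat \<times> nat \<Rightarrow> real) \<Rightarrow> real) set" where
  "tests p n =
     {\<phi> \<in> borel_measurable (matrix_space p n). \<forall>X\<in>space (matrix_space p n). \<phi> X \<in> {0, 1}}"

text \<open>
  Expectations of the \<open>{0,1}\<close>-valued functions are taken in the complete lattice \<^typ>\<open>ennreal\<close>,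
  so that all suprema and infima are meaningful.
\<close>

definition minimax_risk ::
    "real \<Rightarrow> real \<Rightarrow> nat \<Rightarrow> nat \<Rightarrow> nat \<Rightarrow> real \<Rightarrow> ennreal" where
  "minimax_risk \<alpha> K p n s \<rho> =
     (INF \<phi>\<in>tests p n.
        (SUP P\<in>joint_noise_class \<alpha> K p n. SUP \<theta>\<in>null_space p n.
           \<integral>\<^sup>+X. ennreal (\<phi> X) \<partial>obs_law p n \<theta> P) +
        (SUP P\<in>joint_noise_class \<alpha> K p n. SUP \<theta>\<in>alt_space p n s \<rho>.
           \<integral>\<^sup>+X. ennreal (1 - \<phi> X) \<partial>obs_law p n \<theta> P))"

definition omega2 :: "real \<Rightarrow> nat \<Rightarrow> nat \<Rightarrow> nat \<Rightarrow> real" where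
  "omega2 \<alpha> p n s =
     (if real s > sqrt (real p * ln (ln (8 * real n))) \<and> \<alpha> \<ge> 4 then 1 / 2 else 0)"

definition v_lower :: "real \<Rightarrow> nat \<Rightarrow> nat \<Rightarrow> nat \<Rightarrow> real" where
  "v_lower \<alpha> p n s =
     min (real s * (real p / real s) powr (2 / \<alpha>))
         (real p powr max (2 / \<alpha>) (1 / 2) * ln (ln (8 * real n)) powr omega2 \<alpha> p n s)
     + ln (ln (8 * real n))"

end

theory Submission
  imports Defs
begin

text \<open>
  The risk is bounded below by testing a product law \<open>Q\<close> of the null against a mixture of
  alternatives whose chi-square divergence from \<open>Q\<close> is small; by independence the second moment of
  the likelihood ratio is a product over the matrix entries. Since the noise law may depend on the
  alternative, finitely supported laws can replace Gaussian ones: a mean shift is a reweighting of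
  three atoms.

  The mixtures are as follows. (1) The change point is uniform on a geometric grid and one
  coordinate is shifted by \<open>A / sqrt t\<^sub>0\<close>: this gives the rate \<open>log log n\<close>. (2) The shift has random signs on a
  random set of about \<open>s\<close> rows, over the same grid: this gives the rate \<open>sqrt (p log log n)\<close> if \<open>s\<close> exceeds that
  number. (3) Only the first column is shifted, by \<open>\<plusminus> a\<close> in about \<open>s\<close> random rows, while under the null
  the noise itself has spikes at \<open>\<plusminus> a\<close> of the same frequency; the moment condition allows this for
  \<open>a powr \<alpha> \<le> p / s\<close>. The bulk of the null noise must then have variance below 1 by about
  \<open>s a\<^sup>2 / p\<close>, which is invisible as long as \<open>s a\<^sup>2\<close> is at most of order \<open>sqrt p\<close>. (4) For \<open>\<alpha> < 4\<close> a bounded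
  number of shifts of order \<open>p powr (1 / \<alpha>)\<close> hides among more numerous spikes of the null noise.
\<close>

section \<open>Finitely supported noise and reduction to two simple hypotheses\<close>

text \<open>The law of \<open>m\<close> plus a noise variable.\<close>

definition noise_pmf :: "real \<Rightarrow> real \<Rightarrow> real \<Rightarrow> real pmf \<Rightarrow> bool" where
  "noise_pmf \<alpha> K m d \<longleftrightarrow> finite (set_pmf d) \<and>
     measure_pmf.expectation d (\<lambda>x. x) = m \<and>
     measure_pmf.expectation d (\<lambda>x. (x - m)\<^sup>2) = 1 \<and>
     measure_pmf.expectation d (\<lambda>x. \<bar>(x - m) / K\<bar> powr \<alpha>) \<le> 1"

lemma noise_class_pmf:
  assumes "noise_pmf \<alpha> K m d"
  shows "distr (measure_pmf d) borel (\<lambda>x. x - m) \<in> noise_class \<alpha> K"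
proof -
  have fin: "finite (set_pmf d)"
    and mean: "measure_pmf.expectation d (\<lambda>x. x) = m"
    and var: "measure_pmf.expectation d (\<lambda>x. (x - m)\<^sup>2) = 1"
    and mom: "measure_pmf.expectation d (\<lambda>x. \<bar>(x - m) / K\<bar> powr \<alpha>) \<le> 1"
    using assms by (auto simp: noise_pmf_def)
  have [simp]: "integrable (measure_pmf d) f" for f :: "real \<Rightarrow> real"
    by (rule integrable_measure_pmf_finite[OF fin])
  have "measure_pmf.expectation d (\<lambda>x. x - m) = 0"
    using mean by (simp add: Bochner_Integration.integral_diff)
  then show ?thesis
    using var mom
    by (auto simp: noise_class_def integrable_distr_eq integral_distr
        intro!: prob_space.prob_space_distr measure_pmf.prob_space_axioms)
qed

lemma finite_matrix_index [simp]: "finite (matrix_index p n)"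
  by (simp add: matrix_index_def)

lemma restrict_in_matrix_space [simp]: "(\<lambda>j\<in>matrix_index p n. f j) \<in> space (matrix_space p n)"
  by (simp add: matrix_space_def space_PiM)

lemma measurable_pmf_matrix_space [measurable]:
  "(\<lambda>x. \<lambda>j\<in>matrix_index p n. f j x) \<in> measurable (measure_pmf M) (matrix_space p n)"
  by simp

text \<open>The default \<open>undefined\<close> off the index set makes the support a set of
  extensional functions, as in \<open>matrix_space\<close>.\<close>

definition joint_pmf :: "nat \<Rightarrow> nat \<Rightarrow> (nat \<times> nat \<Rightarrow> real pmf) \<Rightarrow> (nat \<times> nat \<Rightarrow> real) pmf" where
  "joint_pmf p n d = Pi_pmf (matrix_index p n) undefined d"

text \<open>\<open>d\<close> prescribes the laws of the observed entries, and the signal \<theta> is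
  subtracted to recover the noise. Null and alternatives can then be compared on one finite
  support.\<close>

definition joint_noise ::
    "nat \<Rightarrow> nat \<Rightarrow> (nat \<times> nat \<Rightarrow> real) \<Rightarrow> (nat \<times> nat \<Rightarrow> real pmf) \<Rightarrow> (nat \<times> nat \<Rightarrow> real) measure" where
  "joint_noise p n \<theta> d =
     distr (joint_pmf p n d) (matrix_space p n) (\<lambda>x. \<lambda>j\<in>matrix_index p n. x j - \<theta> j)"

text \<open>Shifting coordinates keeps them independent, and independence over a nonempty index set
  means that the joint law is the product of its marginals. This criterion is used in both
  directions: to get a product law from independence under the pmf, and to read off independence
  under that law.\<close>

lemma joint_noise_in_class:
  assumes "n \<ge> 1" "p \<ge> 1"
  assumes noise: "\<And>j. j \<in> matrix_index p n \<Longrightarrow> noise_pmf \<alpha> K (\<theta> j) (d j)"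
  shows "joint_noise p n \<theta> d \<in> joint_noise_class \<alpha> K p n"
proof -
  define I where "I = matrix_index p n"
  let ?N = "matrix_space p n" and ?M = "measure_pmf (joint_pmf p n d)"
  let ?P = "joint_noise p n \<theta> d"
  have "(1, 1) \<in> I"
    using assms by (auto simp: I_def matrix_index_def)
  then have ne: "I \<noteq> {}" by auto
  have N: "?N = PiM I (\<lambda>_. borel)"
    by (simp add: matrix_space_def I_def)
  interpret P: prob_space ?P
    unfolding joint_noise_def by (rule prob_space.prob_space_distr[OF measure_pmf.prob_space_axioms]) simp
  have coord: "distr ?P borel (\<lambda>E. E j) = distr ?M borel (\<lambda>x. x j - \<theta> j)" if "j \<in> I" for j
  proof -
    have "(\<lambda>E. E j) \<in> measurable ?N borel"
      unfolding N using that by measurable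
    then show ?thesis
      unfolding joint_noise_def using that
      by (subst distr_distr) (auto simp: I_def comp_def intro!: distr_cong)
  qed
  have "prob_space.indep_vars ?M (\<lambda>_. count_space UNIV) (\<lambda>j x. x j) I"
    unfolding joint_pmf_def I_def by (rule indep_vars_Pi_pmf) simp
  then have "prob_space.indep_vars ?M (\<lambda>_. borel) (\<lambda>j x. x j - \<theta> j) I"
    by (rule prob_space.indep_vars_compose2[OF measure_pmf.prob_space_axioms]) simp
  then have prod: "distr ?M ?N (\<lambda>x. \<lambda>j\<in>I. x j - \<theta> j) = PiM I (\<lambda>j. distr ?M borel (\<lambda>x. x j - \<theta> j))"
    using ne unfolding N by (subst (asm) prob_space.indep_vars_iff_distr_eq_PiM'[OF measure_pmf.prob_space_axioms]) auto
  have meas: "(\<lambda>E. E j) \<in> measurable ?P borel" if "j \<in> I" for j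
    unfolding joint_noise_def measurable_distr_eq1 N using that by measurable
  have "distr ?P ?N (\<lambda>E. \<lambda>j\<in>I. E j) = ?P"
  proof -
    have "distr ?P ?N (\<lambda>E. \<lambda>j\<in>I. E j) = distr ?P ?N (\<lambda>E. E)"
      by (rule distr_cong) (auto simp: joint_noise_def N space_PiM PiE_restrict)
    also have "\<dots> = ?P"
      by (rule distr_id2) (simp add: joint_noise_def)
    finally show ?thesis .
  qed
  also have "\<dots> = PiM I (\<lambda>j. distr ?P borel (\<lambda>E. E j))"
  proof -
    have "?P = PiM I (\<lambda>j. distr ?M borel (\<lambda>x. x j - \<theta> j))"
      using prod by (simp add: joint_noise_def I_def)
    also have "\<dots> = PiM I (\<lambda>j. distr ?P borel (\<lambda>E. E j))"
      by (rule PiM_cong) (simp_all add: coord)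
    finally show ?thesis .
  qed
  finally have "P.indep_vars (\<lambda>_. borel) (\<lambda>j E. E j) I"
    using ne meas unfolding N by (subst P.indep_vars_iff_distr_eq_PiM') auto
  moreover have "distr ?P borel (\<lambda>E. E j) \<in> noise_class \<alpha> K" if "j \<in> I" for j
  proof -
    have "distr ?M borel (\<lambda>x. x j - \<theta> j)
        = distr (measure_pmf (map_pmf (\<lambda>x. x j) (joint_pmf p n d))) borel (\<lambda>x. x - \<theta> j)"
      unfolding map_pmf_rep_eq by (subst distr_distr) (auto simp: comp_def)
    also have "map_pmf (\<lambda>x. x j) (joint_pmf p n d) = d j"
      unfolding joint_pmf_def using that by (subst Pi_pmf_component) (auto simp: I_def)
    finally show ?thesis
      using noise_class_pmf[OF noise] that by (simp add: coord I_def)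
  qed
  ultimately show ?thesis
    using P.prob_space_axioms unfolding joint_noise_class_def I_def
    by (auto simp: joint_noise_def)
qed

text \<open>Adding the signal undoes the subtraction in \<open>joint_noise\<close>, so error
  probabilities become probabilities under the pmf of the observations.\<close>

lemma nn_integral_obs_law:
  assumes [measurable]: "f \<in> borel_measurable (matrix_space p n)"
  shows "(\<integral>\<^sup>+X. f X \<partial>obs_law p n \<theta> (joint_noise p n \<theta> d)) =
    (\<integral>\<^sup>+x. f (restrict x (matrix_index p n)) \<partial>joint_pmf p n d)"
proof -
  let ?N = "matrix_space p n"
  have m: "(\<lambda>E. \<lambda>j\<in>matrix_index p n. \<theta> j + E j) \<in> measurable ?N ?N"
    unfolding matrix_space_def by measurable
  have "obs_law p n \<theta> (joint_noise p n \<theta> d) =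
      distr (joint_pmf p n d) ?N (\<lambda>x. \<lambda>j\<in>matrix_index p n. x j)"
    unfolding obs_law_def joint_noise_def using m
    by (subst distr_distr) (auto intro!: distr_cong simp: comp_def)
  then show ?thesis
    by (simp add: nn_integral_distr)
qed

text \<open>Le Cam's method with a prior \<open>W\<close>. The worst type II error dominates its
  average over \<open>W\<close>, up to the mass 1/4 that \<open>W\<close> may leave outside
  \<open>alt_space\<close>; another 1/4 is lost in passing from the mixture to the null law, and 1 -
  1/4 - 1/4 = 1/2. The noise may differ between null and alternatives because each error has its own
  supremum over noise laws.\<close>

lemma minimax_risk_ge_half:
  fixes W :: "'w pmf"
  assumes "n \<ge> 1" "p \<ge> 1" and fin: "finite (set_pmf W)"
  assumes null: "\<And>j. j \<in> matrix_index p n \<Longrightarrow> noise_pmf \<alpha> K 0 (q j)"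
  assumes alt: "\<And>w j. w \<in> set_pmf W \<Longrightarrow> j \<in> matrix_index p n \<Longrightarrow> noise_pmf \<alpha> K (\<theta> w j) (d w j)"
  assumes good: "measure W {w. \<theta> w \<in> alt_space p n s \<rho>} \<ge> 3 / 4"
  assumes tv: "\<And>A. measure (bind_pmf W (\<lambda>w. joint_pmf p n (d w))) A - measure (joint_pmf p n q) A \<le> 1 / 4"
  shows "minimax_risk \<alpha> K p n s \<rho> \<ge> 1 / 2"
  unfolding minimax_risk_def
proof (rule INF_greatest)
  fix \<phi> assume \<phi>: "\<phi> \<in> tests p n"
  then have [measurable]: "\<phi> \<in> borel_measurable (matrix_space p n)"
    by (simp add: tests_def)
  have \<phi>01: "\<phi> (restrict x (matrix_index p n)) \<in> {0, 1}" for x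
    using \<phi> by (simp add: tests_def)
  define A where "A = {x. \<phi> (restrict x (matrix_index p n)) = 1}"
  define S1 where "S1 = (SUP P\<in>joint_noise_class \<alpha> K p n. SUP \<theta>\<in>null_space p n.
           \<integral>\<^sup>+X. ennreal (\<phi> X) \<partial>obs_law p n \<theta> P)"
  define S2 where "S2 = (SUP P\<in>joint_noise_class \<alpha> K p n. SUP \<theta>\<in>alt_space p n s \<rho>.
           \<integral>\<^sup>+X. ennreal (1 - \<phi> X) \<partial>obs_law p n \<theta> P)"
  define z :: "nat \<times> nat \<Rightarrow> real" where "z = (\<lambda>j\<in>matrix_index p n. 0)"
  have zn: "z \<in> null_space p n"
    unfolding null_space_def z_def
    by (intro CollectI conjI restrict_in_matrix_space exI[of _ "\<lambda>_. 0"]) (simp add: matrix_index_def)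
  have indA: "ennreal (\<phi> (restrict x (matrix_index p n))) = indicator A x"
    "ennreal (1 - \<phi> (restrict x (matrix_index p n))) = indicator (- A) x" for x
    using \<phi>01[of x] by (auto simp: A_def indicator_def)
  have "ennreal (measure (joint_pmf p n q) A) =
      (\<integral>\<^sup>+X. ennreal (\<phi> X) \<partial>obs_law p n z (joint_noise p n z q))"
    by (subst nn_integral_obs_law) (auto simp: indA measure_pmf.emeasure_eq_measure)
  also have "\<dots> \<le> S1"
    unfolding S1_def using null assms(1,2) zn
    by (intro SUP_upper2[of "joint_noise p n z q"] SUP_upper2[of z] joint_noise_in_class)
      (auto simp: z_def)
  finally have S1: "ennreal (measure (joint_pmf p n q) A) \<le> S1" .
  have S2: "ennreal (measure (joint_pmf p n (d w)) (- A)) \<le> S2"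
    if "w \<in> set_pmf W" "\<theta> w \<in> alt_space p n s \<rho>" for w
  proof -
    have "ennreal (measure (joint_pmf p n (d w)) (- A)) =
      (\<integral>\<^sup>+X. ennreal (1 - \<phi> X) \<partial>obs_law p n (\<theta> w) (joint_noise p n (\<theta> w) (d w)))"
      by (subst nn_integral_obs_law) (auto simp: indA measure_pmf.emeasure_eq_measure)
    also have "\<dots> \<le> S2"
      unfolding S2_def using alt assms(1,2) that
      by (intro SUP_upper2[of "joint_noise p n (\<theta> w) (d w)"] SUP_upper2[of "\<theta> w"] joint_noise_in_class)
        auto
    finally show ?thesis .
  qed
  have "1 / 2 \<le> S1 + S2"
  proof (cases S2)
    case top
    then show ?thesis by simp
  next
    case (real r)
    let ?B = "{w. \<theta> w \<in> alt_space p n s \<rho>}"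
    \<comment> \<open>Outside the genuine alternatives only the trivial bound 1 is
      available.\<close>
    have r: "measure (joint_pmf p n (d w)) (- A) \<le> r + indicator (- ?B) w" if "w \<in> set_pmf W" for w
    proof (cases "w \<in> ?B")
      case True
      then show ?thesis
        using S2[OF that] real by (simp add: ennreal_le_iff)
    next
      case False
      then show ?thesis
        using real measure_pmf.prob_le_1[of "joint_pmf p n (d w)" "- A"] by (simp add: add_increasing)
    qed
    have "measure (bind_pmf W (\<lambda>w. joint_pmf p n (d w))) (- A) =
        measure_pmf.expectation W (\<lambda>w. measure (joint_pmf p n (d w)) (- A))"
      unfolding measure_pmf_bind
      by (rule measure_pmf.measure_bind[where N = "count_space UNIV"])
        (auto simp: measure_pmf_in_subprob_algebra)
    also have "\<dots> \<le> measure_pmf.expectation W (\<lambda>w. r + indicator (- ?B) w)"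
      using r by (intro integral_mono_AE integrable_measure_pmf_finite fin)
        (auto simp: AE_measure_pmf_iff)
    also have "\<dots> = r + measure W (- ?B)"
      by (simp add: integrable_measure_pmf_finite fin)
    also have "\<dots> \<le> r + 1 / 4"
      using good measure_pmf.prob_compl[of ?B W] by (simp add: Compl_eq_Diff_UNIV)
    finally have "measure (bind_pmf W (\<lambda>w. joint_pmf p n (d w))) (- A) \<le> r + 1 / 4" .
    then have "1 / 2 \<le> measure (joint_pmf p n q) A + r"
      using tv[of A] measure_pmf.prob_compl[of A "bind_pmf W (\<lambda>w. joint_pmf p n (d w))"]
      by (simp add: Compl_eq_Diff_UNIV)
    then have "ennreal (1 / 2) \<le> ennreal (measure (joint_pmf p n q) A + r)"
      by (rule ennreal_leI)
    also have "\<dots> = ennreal (measure (joint_pmf p n q) A) + ennreal r"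
      using real by simp
    also have "\<dots> \<le> S1 + S2"
      using S1 real by (simp add: add_mono)
    also have "ennreal (1 / 2) = 1 / 2"
      by (metis ennreal_1 ennreal_divide_numeral zero_le_one)
    finally show ?thesis .
  qed
  then show "1 / 2 \<le> (SUP P\<in>joint_noise_class \<alpha> K p n. SUP \<theta>\<in>null_space p n.
           \<integral>\<^sup>+X. ennreal (\<phi> X) \<partial>obs_law p n \<theta> P) +
        (SUP P\<in>joint_noise_class \<alpha> K p n. SUP \<theta>\<in>alt_space p n s \<rho>.
           \<integral>\<^sup>+X. ennreal (1 - \<phi> X) \<partial>obs_law p n \<theta> P)"
    by (simp add: S1_def S2_def)
qed

section \<open>Second moments of likelihood ratios\<close>

text \<open>The inner product in \<open>L\<^sup>2(q)\<close> of the likelihood ratios \<open>d / q\<close> and \<open>e / q\<close>.\<close>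

definition lr_inner :: "'a pmf \<Rightarrow> 'a pmf \<Rightarrow> 'a pmf \<Rightarrow> real" where
  "lr_inner q d e = (\<Sum>x\<in>set_pmf q. pmf d x * pmf e x / pmf q x)"

lemma measure_pmf_finite_support:
  assumes "finite S" "set_pmf q \<subseteq> S"
  shows "measure (measure_pmf q) A = (\<Sum>x\<in>S. pmf q x * indicator A x)"
proof -
  have "measure (measure_pmf q) A = measure_pmf.expectation q (indicator A)"
    by simp
  also have "\<dots> = (\<Sum>x\<in>S. indicator A x * pmf q x)"
    using assms by (intro integral_measure_pmf_real) auto
  finally show ?thesis by (simp add: mult.commute)
qed

text \<open>The sum on the right is the chi-square divergence of \<open>m\<close> from
  \<open>q\<close>. The cross term of the expanded square sums to -2 because \<open>m\<close> lives
  on the support of \<open>q\<close>.\<close>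

lemma lr_inner_eq_chi_square:
  assumes "finite (set_pmf q)" "set_pmf m \<subseteq> set_pmf q"
  shows "lr_inner q m m = 1 + (\<Sum>x\<in>set_pmf q. (pmf m x - pmf q x)\<^sup>2 / pmf q x)"
proof -
  have "(\<Sum>x\<in>set_pmf q. (pmf m x - pmf q x)\<^sup>2 / pmf q x) =
      (\<Sum>x\<in>set_pmf q. pmf m x * pmf m x / pmf q x - 2 * pmf m x + pmf q x)"
    by (rule sum.cong) (auto simp: field_simps power2_eq_square set_pmf_iff)
  also have "\<dots> = lr_inner q m m - 2 * (\<Sum>x\<in>set_pmf q. pmf m x) + (\<Sum>x\<in>set_pmf q. pmf q x)"
    by (simp add: lr_inner_def sum.distrib sum_subtractf sum_distrib_left)
  also have "\<dots> = lr_inner q m m - 1"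
    using assms by (simp add: sum_pmf_eq_1)
  finally show ?thesis by simp
qed

text \<open>With chi-square divergence at most 1/16, a weighted AM-GM inequality in place of
  Cauchy-Schwarz gives 2/16 + 1/8 = 1/4. This is the origin of the threshold 17/16.\<close>

lemma measure_diff_le_of_lr_inner:
  assumes "finite (set_pmf q)" "set_pmf m \<subseteq> set_pmf q" "lr_inner q m m \<le> 17 / 16"
  shows "measure (measure_pmf m) A - measure (measure_pmf q) A \<le> 1 / 4"
proof -
  let ?S = "set_pmf q"
  have "measure (measure_pmf m) A - measure (measure_pmf q) A =
      (\<Sum>x\<in>?S. (pmf m x - pmf q x) * indicator A x)"
    using assms by (simp add: measure_pmf_finite_support[of ?S] algebra_simps sum_subtractf)
  \<comment> \<open>AM-GM: \<open>u \<le> 2 u\<^sup>2 / w + w / 8\<close>\<close>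
  also have "\<dots> \<le> (\<Sum>x\<in>?S. 2 * ((pmf m x - pmf q x)\<^sup>2 / pmf q x) + pmf q x / 8)"
  proof (rule sum_mono)
    fix x assume "x \<in> ?S"
    then have q: "pmf q x > 0" by (simp add: pmf_positive)
    define u where "u = pmf m x - pmf q x"
    have "0 \<le> (4 * u - pmf q x)\<^sup>2 / (8 * pmf q x)" using q by simp
    also have "\<dots> = 2 * (u\<^sup>2 / pmf q x) + pmf q x / 8 - u"
      using q by (simp add: field_simps power2_eq_square)
    finally have "u \<le> 2 * (u\<^sup>2 / pmf q x) + pmf q x / 8" by simp
    moreover have "0 \<le> 2 * (u\<^sup>2 / pmf q x) + pmf q x / 8" using q by simp
    ultimately show "(pmf m x - pmf q x) * indicator A x \<le>
        2 * ((pmf m x - pmf q x)\<^sup>2 / pmf q x) + pmf q x / 8"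
      by (auto simp: u_def indicator_def)
  qed
  also have "\<dots> = 2 * (lr_inner q m m - 1) + 1 / 8"
    using assms by (simp add: lr_inner_eq_chi_square sum.distrib sum_distrib_left[symmetric]
        sum_divide_distrib[symmetric] sum_pmf_eq_1 del: times_divide_eq_right)
  also have "\<dots> \<le> 1 / 4" using assms by simp
  finally show ?thesis .
qed

lemma lr_inner_nonneg: "lr_inner q d e \<ge> 0"
  by (simp add: lr_inner_def sum_nonneg)

text \<open>Bilinearity: the second moment of a mixture is an average over two independent draws
  from the prior.\<close>

lemma lr_inner_bind:
  assumes [simp]: "finite (set_pmf V)" "finite (set_pmf W)"
  shows "lr_inner q (bind_pmf V d) (bind_pmf W e) =
    measure_pmf.expectation V (\<lambda>v. measure_pmf.expectation W (\<lambda>w. lr_inner q (d v) (e w)))"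
proof -
  have [simp]: "integrable (measure_pmf V) f" "integrable (measure_pmf W) g" for f g :: "_ \<Rightarrow> real"
    by (simp_all add: integrable_measure_pmf_finite)
  show ?thesis
    unfolding lr_inner_def by (simp add: pmf_bind sum_divide_distrib)
qed

text \<open>In this form the product rule for expectations under \<open>Pi_pmf\<close> applies; one
  factor \<open>pmf q x\<close> of the denominator compensates the weight.\<close>

lemma lr_inner_eq_expectation:
  assumes "finite (set_pmf q)"
  shows "lr_inner q d e = measure_pmf.expectation q (\<lambda>x. pmf d x * pmf e x / (pmf q x)\<^sup>2)"
  using assms unfolding lr_inner_def
  by (subst integral_measure_pmf_real[of "set_pmf q"])
    (auto intro!: sum.cong simp: set_pmf_iff power2_eq_square)

text \<open>Likelihood ratios of product laws factor over the coordinates, and so do their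
  expectations by independence.\<close>

lemma lr_inner_Pi_pmf:
  assumes [simp]: "finite I" and fin: "\<And>j. j \<in> I \<Longrightarrow> finite (set_pmf (q j))"
  shows "lr_inner (Pi_pmf I u q) (Pi_pmf I u d) (Pi_pmf I u e) = (\<Prod>j\<in>I. lr_inner (q j) (d j) (e j))"
proof -
  have "finite (set_pmf (Pi_pmf I u q))"
    using fin by (simp add: set_Pi_pmf finite_PiE_dflt)
  then have "lr_inner (Pi_pmf I u q) (Pi_pmf I u d) (Pi_pmf I u e) =
      measure_pmf.expectation (Pi_pmf I u q)
        (\<lambda>x. pmf (Pi_pmf I u d) x * pmf (Pi_pmf I u e) x / (pmf (Pi_pmf I u q) x)\<^sup>2)"
    by (rule lr_inner_eq_expectation)
  also have "\<dots> = measure_pmf.expectation (Pi_pmf I u q)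
        (\<lambda>x. \<Prod>j\<in>I. pmf (d j) (x j) * pmf (e j) (x j) / (pmf (q j) (x j))\<^sup>2)"
  proof (rule integral_cong_AE)
    show "AE x in Pi_pmf I u q. pmf (Pi_pmf I u d) x * pmf (Pi_pmf I u e) x / (pmf (Pi_pmf I u q) x)\<^sup>2 =
        (\<Prod>j\<in>I. pmf (d j) (x j) * pmf (e j) (x j) / (pmf (q j) (x j))\<^sup>2)"
      using set_Pi_pmf_subset[OF assms(1), of u q]
      by (auto simp: AE_measure_pmf_iff pmf_Pi prod.distrib prod_dividef prod_power_distrib)
  qed simp_all
  also have "\<dots> = (\<Prod>j\<in>I. measure_pmf.expectation (q j) (\<lambda>y. pmf (d j) y * pmf (e j) y / (pmf (q j) y)\<^sup>2))"
    by (rule expectation_prod_Pi_pmf) (auto intro!: integrable_measure_pmf_finite fin)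
  also have "\<dots> = (\<Prod>j\<in>I. lr_inner (q j) (d j) (e j))"
    using fin by (simp add: lr_inner_eq_expectation)
  finally show ?thesis .
qed

text \<open>This carries the average over two independent label vectors through the product over
  rows: first for the inner vector, then for the outer one.\<close>

lemma expectation_prod_Pi_pmf_pair:
  fixes f :: "_ \<Rightarrow> _ \<Rightarrow> _ \<Rightarrow> real"
  assumes A: "finite A" and fin: "\<And>i. i \<in> A \<Longrightarrow> finite (set_pmf (P i))"
    and nonneg: "\<And>i y z. f i y z \<ge> 0"
  shows "measure_pmf.expectation (Pi_pmf A u P) (\<lambda>y. measure_pmf.expectation (Pi_pmf A u P)
      (\<lambda>z. \<Prod>i\<in>A. f i (y i) (z i))) =
    (\<Prod>i\<in>A. measure_pmf.expectation (P i) (\<lambda>y. measure_pmf.expectation (P i) (f i y)))"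
proof -
  have "measure_pmf.expectation (Pi_pmf A u P) (\<lambda>z. \<Prod>i\<in>A. f i (y i) (z i)) =
      (\<Prod>i\<in>A. measure_pmf.expectation (P i) (f i (y i)))" for y
    using A nonneg by (intro expectation_prod_Pi_pmf integrable_measure_pmf_finite fin)
  moreover have "measure_pmf.expectation (Pi_pmf A u P)
      (\<lambda>y. \<Prod>i\<in>A. measure_pmf.expectation (P i) (f i (y i))) =
    (\<Prod>i\<in>A. measure_pmf.expectation (P i) (\<lambda>y. measure_pmf.expectation (P i) (f i y)))"
    using A nonneg by (intro expectation_prod_Pi_pmf[where f = "\<lambda>i y. measure_pmf.expectation (P i) (f i y)"]
        integrable_measure_pmf_finite fin) (auto intro: integral_nonneg_AE)
  ultimately show ?thesis by simp
qed

lemma set_joint_pmf: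
  "set_pmf (joint_pmf p n d) = PiE (matrix_index p n) (\<lambda>j. set_pmf (d j))"
  unfolding joint_pmf_def by (subst set_Pi_pmf) (auto simp: PiE_dflt_def PiE_def extensional_def Pi_def)

text \<open>The prior draws a change point \<open>k\<close> uniformly from \<open>G\<close> and
  independent row labels \<open>y i\<close>. Row \<open>i\<close> has mean \<open>y i * a k\<close>
  up to column \<open>k\<close> and mean 0 afterwards. The entry law \<open>d k y t\<close> may
  depend on the label even where the mean is 0. By independence the second moment is, for each pair
  of change points, a product over rows, which is the quantity in \<open>chi\<close>.\<close>

lemma minimax_risk_ge_half_of_prior:
  fixes a :: "nat \<Rightarrow> real" and lab :: "nat \<Rightarrow> real pmf"
  assumes n: "n \<ge> 1" and p: "p \<ge> 1"
  assumes G: "G \<noteq> {}" "G \<subseteq> {1..n-1}"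
  assumes lab: "\<And>i. set_pmf (lab i) \<subseteq> {-1, 0, 1}"
  assumes null: "\<And>t. noise_pmf \<alpha> K 0 (q t)"
  assumes alt: "\<And>k y t. k \<in> G \<Longrightarrow> y \<in> {-1, 0, 1} \<Longrightarrow>
      noise_pmf \<alpha> K (if t \<le> k then y * a k else 0) (d k y t)"
  assumes supp: "\<And>k y t. k \<in> G \<Longrightarrow> y \<in> {-1, 0, 1} \<Longrightarrow> set_pmf (d k y t) \<subseteq> set_pmf (q t)"
  assumes good: "measure (Pi_pmf {1..p} 0 lab)
      {y. l0_norm p y \<le> s \<and>
          (\<forall>k\<in>G. \<rho>\<^sup>2 \<le> real k * (real n - real k) / real n * ((a k)\<^sup>2 * l0_norm p y))} \<ge> 3 / 4"
  assumes chi: "(\<Sum>k\<in>G. \<Sum>l\<in>G. \<Prod>i\<in>{1..p}.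
        measure_pmf.expectation (lab i) (\<lambda>y. measure_pmf.expectation (lab i) (\<lambda>z.
          \<Prod>t\<in>{1..n}. lr_inner (q t) (d k y t) (d l z t)))) \<le> 17 / 16 * (real (card G))\<^sup>2"
  shows "minimax_risk \<alpha> K p n s \<rho> \<ge> 1 / 2"
proof -
  define I where "I = matrix_index p n"
  define L where "L = Pi_pmf {1..p} 0 lab"
  define W where "W = pair_pmf (pmf_of_set G) L"
  define \<theta> :: "nat \<times> (nat \<Rightarrow> real) \<Rightarrow> nat \<times> nat \<Rightarrow> real" where
    "\<theta> = (\<lambda>(k, y). \<lambda>(i, t)\<in>matrix_index p n. if t \<le> k then y i * a k else 0)"
  define D where "D = (\<lambda>(k, y) (i :: nat, t). d k (y i :: real) t)"
  define Q where "Q = joint_pmf p n (\<lambda>(i, t). q t)"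
  define P where "P = (\<lambda>w. joint_pmf p n (D w))"
  have finG [simp]: "finite G"
    using G(2) finite_subset by blast
  have finlab [simp]: "finite (set_pmf (lab i))" for i
    using lab[of i] by (rule finite_subset) simp
  have finL [simp]: "finite (set_pmf L)"
    by (simp add: L_def set_Pi_pmf finite_PiE_dflt)
  have finq [simp]: "finite (set_pmf (q t))" for t
    using null[of t] by (simp add: noise_pmf_def)
  have finQ [simp]: "finite (set_pmf Q)"
    by (auto simp: Q_def set_joint_pmf intro!: finite_PiE)
  have setW: "set_pmf W = G \<times> set_pmf L"
    using G by (simp add: W_def)
  have yL: "y i \<in> {-1, 0, 1}" if "y \<in> set_pmf L" "i \<in> {1..p}" for y i
    using that lab[of i] by (auto simp: L_def set_Pi_pmf PiE_dflt_def)
  have suppP: "set_pmf (P w) \<subseteq> set_pmf Q" if "w \<in> set_pmf W" for w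
    unfolding P_def Q_def set_joint_pmf
  proof (rule PiE_mono)
    fix j assume "j \<in> matrix_index p n"
    then show "set_pmf (D w j) \<subseteq> set_pmf (case j of (i, t) \<Rightarrow> q t)"
      using that supp[of "fst w" "snd w (fst j)" "snd j"] yL[of "snd w" "fst j"]
      by (cases w; cases j) (simp add: D_def setW matrix_index_def)
  qed
  show ?thesis
  proof (rule minimax_risk_ge_half[where W = W and \<theta> = \<theta> and d = D and q = "\<lambda>(i, t). q t"])
    show "noise_pmf \<alpha> K 0 (case j of (i, t) \<Rightarrow> q t)" for j
      using null by (auto split: prod.split)
    show "noise_pmf \<alpha> K (\<theta> w j) (D w j)" if "w \<in> set_pmf W" "j \<in> matrix_index p n" for w j
    proof -
      obtain k y i t where [simp]: "w = (k, y)" "j = (i, t)" by fastforce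
      have "k \<in> G" "y \<in> set_pmf L" "i \<in> {1..p}"
        using that by (auto simp: setW matrix_index_def)
      then show ?thesis
        using alt[of k "y i" t] yL[of y i] that by (simp add: \<theta>_def D_def)
    qed
    show "3 / 4 \<le> measure W {w. \<theta> w \<in> alt_space p n s \<rho>}"
    proof -
      define B where "B = {y. l0_norm p y \<le> s \<and>
          (\<forall>k\<in>G. \<rho>\<^sup>2 \<le> real k * (real n - real k) / real n * ((a k)\<^sup>2 * l0_norm p y))}"
      have "measure L B = measure (map_pmf snd W) B"
        by (simp add: W_def map_snd_pair_pmf)
      also have "\<dots> = measure W (UNIV \<times> B)"
        unfolding measure_map_pmf by (rule arg_cong[where f = "measure W"]) auto
      also have "\<dots> \<le> measure W {w. \<theta> w \<in> alt_space p n s \<rho>}"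
      proof (rule measure_pmf.finite_measure_mono_AE)
        show "AE w in W. w \<in> UNIV \<times> B \<longrightarrow> w \<in> {w. \<theta> w \<in> alt_space p n s \<rho>}"
          unfolding AE_measure_pmf_iff
        proof (intro ballI impI)
          fix w assume w: "w \<in> set_pmf W" "w \<in> UNIV \<times> B"
          obtain k y where [simp]: "w = (k, y)" by fastforce
          have k: "k \<in> G" and y: "y \<in> set_pmf L" "y \<in> B"
            using w by (auto simp: setW)
          \<comment> \<open>Equality can fail, since \<open>a k\<close> may be 0.\<close>
          have "l0_norm p (\<lambda>i. y i * a k - 0) \<le> l0_norm p y"
            unfolding l0_norm_def by (rule card_mono) auto
          moreover have "(l2_norm p (\<lambda>i. y i * a k - 0))\<^sup>2 = (a k)\<^sup>2 * l0_norm p y"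
          proof -
            have "(l2_norm p (\<lambda>i. y i * a k - 0))\<^sup>2 = (\<Sum>i\<in>{1..p}. (y i * a k)\<^sup>2)"
              by (simp add: l2_norm_def L2_set_def sum_nonneg)
            also have "\<dots> = (\<Sum>i\<in>{1..p}. (a k)\<^sup>2 * (if y i \<noteq> 0 then 1 else 0))"
              using yL[OF y(1)] by (intro sum.cong) (fastforce simp: power_mult_distrib)+
            also have "\<dots> = (a k)\<^sup>2 * l0_norm p y"
              by (simp add: sum_distrib_left[symmetric] l0_norm_def sum.If_cases Int_def)
            finally show ?thesis .
          qed
          ultimately have "\<theta> w \<in> alt_space_at k p n s \<rho>"
            using y(2) k unfolding alt_space_at_def B_def \<theta>_def
            by (intro CollectI conjI exI[of _ "\<lambda>i. y i * a k"] exI[of _ "\<lambda>_. 0"])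
              (auto simp: matrix_index_def[symmetric], auto simp: matrix_index_def)
          then show "w \<in> {w. \<theta> w \<in> alt_space p n s \<rho>}"
            using k G(2) by (auto simp: alt_space_def)
        qed
      qed simp
      finally show ?thesis
        using good by (simp add: B_def L_def)
    qed
    show "measure (bind_pmf W (\<lambda>w. joint_pmf p n (D w))) A -
        measure (joint_pmf p n (\<lambda>(i, t). q t)) A \<le> 1 / 4" for A
      unfolding P_def[symmetric] Q_def[symmetric]
    proof (rule measure_diff_le_of_lr_inner)
      have bindW: "bind_pmf W P = bind_pmf (pmf_of_set G) (\<lambda>k. bind_pmf L (\<lambda>y. P (k, y)))"
        by (simp add: W_def pair_pmf_def bind_assoc_pmf bind_return_pmf)
      have "lr_inner Q (P (k, y)) (P (l, z)) =
          (\<Prod>i\<in>{1..p}. \<Prod>t\<in>{1..n}. lr_inner (q t) (d k (y i) t) (d l (z i) t))" for k l y z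
        unfolding Q_def P_def joint_pmf_def
        by (subst lr_inner_Pi_pmf)
          (auto simp: prod.cartesian_product matrix_index_def D_def intro!: prod.cong)
      then have inner: "measure_pmf.expectation L (\<lambda>y. measure_pmf.expectation L (\<lambda>z.
          lr_inner Q (P (k, y)) (P (l, z)))) = (\<Prod>i\<in>{1..p}.
        measure_pmf.expectation (lab i) (\<lambda>y. measure_pmf.expectation (lab i) (\<lambda>z.
          \<Prod>t\<in>{1..n}. lr_inner (q t) (d k y t) (d l z t))))" for k l
        unfolding L_def
        by (simp only: expectation_prod_Pi_pmf_pair[where A = "{1..p}" and u = 0 and P = lab and
              f = "\<lambda>i y z. \<Prod>t\<in>{1..n}. lr_inner (q t) (d k y t) (d l z t)"]
            finite_atLeastAtMost finlab prod_nonneg lr_inner_nonneg)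
      have "lr_inner Q (bind_pmf W P) (bind_pmf W P) = (\<Sum>k\<in>G. \<Sum>l\<in>G.
          measure_pmf.expectation L (\<lambda>y. measure_pmf.expectation L (\<lambda>z.
          lr_inner Q (P (k, y)) (P (l, z))))) / (real (card G))\<^sup>2"
        unfolding bindW using G
        by (simp add: lr_inner_bind integral_pmf_of_set sum_divide_distrib power2_eq_square)
      also have "\<dots> = (\<Sum>k\<in>G. \<Sum>l\<in>G. \<Prod>i\<in>{1..p}.
        measure_pmf.expectation (lab i) (\<lambda>y. measure_pmf.expectation (lab i) (\<lambda>z.
          \<Prod>t\<in>{1..n}. lr_inner (q t) (d k y t) (d l z t)))) / (real (card G))\<^sup>2"
        by (simp only: inner)
      also have "\<dots> \<le> 17 / 16"
      proof -
        have "0 < (real (card G))\<^sup>2" using G by (simp add: card_gt_0_iff)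
        then show ?thesis using chi by (simp only: pos_divide_le_eq)
      qed
      finally show "lr_inner Q (bind_pmf W P) (bind_pmf W P) \<le> 17 / 16" .
    qed (use suppP in auto)
  qed (use n p setW in auto)
qed

section \<open>Geometric grids of change points\<close>

definition three :: "real \<Rightarrow> real \<Rightarrow> real \<Rightarrow> real pmf" where
  "three b u v = pmf_of_list [(b, u), (- b, v), (0, 1 - u - v)]"

context
  fixes b u v :: real
  assumes b: "b > 0" and u: "u \<ge> 0" and v: "v \<ge> 0" and uv: "u + v \<le> 1"
begin

lemma pmf_three:
  "pmf (three b u v) x = (if x = b then u else if x = - b then v else if x = 0 then 1 - u - v else 0)"
proof -
  have "pmf_of_list_wf [(b, u), (- b, v), (0, 1 - u - v)]"
    using u v uv by (auto simp: pmf_of_list_wf_def)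
  then show ?thesis
    unfolding three_def by (subst pmf_pmf_of_list) (use b in \<open>auto simp del: minus_equation_iff\<close>)
qed

lemma set_pmf_three: "set_pmf (three b u v) \<subseteq> {b, - b, 0}"
  unfolding set_pmf_eq pmf_three by auto

lemma finite_set_pmf_three: "finite (set_pmf (three b u v))"
  using set_pmf_three by (rule finite_subset) simp

lemma expectation_three:
  "measure_pmf.expectation (three b u v) f = u * f b + v * f (- b) + (1 - u - v) * (f 0 :: real)"
  using b set_pmf_three
  by (subst integral_measure_pmf_real[of "{b, - b, 0}"]) (auto simp: pmf_three)

end

text \<open>The law on \<open>{-2, 0, 2}\<close> with mean \<open>\<delta>\<close> and variance 1.\<close>

definition tilt :: "real \<Rightarrow> real pmf" where
  "tilt \<delta> = three 2 ((1 + \<delta>)\<^sup>2 / 8) ((1 - \<delta>)\<^sup>2 / 8)"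

lemma tilt_weights:
  fixes \<delta> :: real
  assumes "\<bar>\<delta>\<bar> \<le> 1"
  shows "(0::real) < 2" "0 \<le> (1 + \<delta>)\<^sup>2 / 8" "0 \<le> (1 - \<delta>)\<^sup>2 / 8" "(1 + \<delta>)\<^sup>2 / 8 + (1 - \<delta>)\<^sup>2 / 8 \<le> 1"
proof -
  have "\<delta>\<^sup>2 \<le> 1" using assms abs_square_le_1 by blast
  then show "(1 + \<delta>)\<^sup>2 / 8 + (1 - \<delta>)\<^sup>2 / 8 \<le> 1" by (simp add: power2_sum power2_diff add_divide_distrib diff_divide_distrib)
qed simp_all

context
  fixes \<delta> :: real
  assumes \<delta>: "\<bar>\<delta>\<bar> \<le> 1"
begin

lemmas pmf_tilt = pmf_three[OF tilt_weights[OF \<delta>], folded tilt_def]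
lemmas set_pmf_tilt = set_pmf_three[OF tilt_weights[OF \<delta>], folded tilt_def]
lemmas finite_set_pmf_tilt = finite_set_pmf_three[OF tilt_weights[OF \<delta>], folded tilt_def]
lemmas expectation_tilt = expectation_three[OF tilt_weights[OF \<delta>], folded tilt_def]

end

text \<open>All three atoms are charged, so every \<open>tilt \<delta>\<close> with \<delta> in
  [-1, 1] is absolutely continuous with respect to \<open>tilt 0\<close>.\<close>

lemma set_pmf_tilt_0: "set_pmf (tilt 0) = {2, - 2, 0}"
proof -
  have "pmf (tilt 0) x = (if x = 2 then 1 / 8 else if x = - 2 then 1 / 8 else if x = 0 then 3 / 4 else 0)" for x
    using pmf_tilt[of 0 x] by simp
  then show ?thesis
    unfolding set_pmf_eq by (auto split: if_splits)
qed

lemma noise_pmf_of_bounded: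
  assumes fin: "finite (set_pmf d)" and "\<alpha> \<ge> 0" "K > 0"
    and "measure_pmf.expectation d (\<lambda>x. x) = m"
    and "measure_pmf.expectation d (\<lambda>x. (x - m)\<^sup>2) = 1"
    and bd: "\<And>x. x \<in> set_pmf d \<Longrightarrow> \<bar>x - m\<bar> \<le> K"
  shows "noise_pmf \<alpha> K m d"
proof -
  have "measure_pmf.expectation d (\<lambda>x. \<bar>(x - m) / K\<bar> powr \<alpha>) \<le> measure_pmf.expectation d (\<lambda>x. 1)"
    using bd assms(2,3)
    by (intro integral_mono_AE integrable_measure_pmf_finite fin)
      (auto simp: AE_measure_pmf_iff intro!: powr_le1)
  then show ?thesis using assms by (simp add: noise_pmf_def)
qed

lemma noise_pmf_tilt:
  assumes "\<alpha> \<ge> 0" "K \<ge> 16" "\<bar>\<delta>\<bar> \<le> 1"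
  shows "noise_pmf \<alpha> K \<delta> (tilt \<delta>)"
proof (rule noise_pmf_of_bounded)
  show "finite (set_pmf (tilt \<delta>))"
    using assms(3) by (rule finite_set_pmf_tilt)
  show "\<bar>x - \<delta>\<bar> \<le> K" if "x \<in> set_pmf (tilt \<delta>)" for x
    using that set_pmf_tilt[OF assms(3)] assms(2,3) by auto
  show "measure_pmf.expectation (tilt \<delta>) (\<lambda>x. x) = \<delta>"
    unfolding expectation_tilt[OF assms(3)] by (simp add: power2_eq_square algebra_simps add_divide_distrib diff_divide_distrib)
  show "measure_pmf.expectation (tilt \<delta>) (\<lambda>x. (x - \<delta>)\<^sup>2) = 1"
    unfolding expectation_tilt[OF assms(3)] by (simp add: power2_eq_square algebra_simps add_divide_distrib diff_divide_distrib)
qed (use assms in auto)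

text \<open>The likelihood ratio of \<open>tilt \<delta>\<close> is 1 + \<delta> x + \<delta>^2
  h(x), where h is 1 at 2 and -2, and -1/3 at 0. Under \<open>tilt 0\<close> the functions 1, x and
  h are orthogonal with squared norms 1, 1 and 1/3.\<close>

lemma lr_inner_tilt:
  assumes "\<bar>\<delta>\<bar> \<le> 1" "\<bar>\<epsilon>\<bar> \<le> 1"
  shows "lr_inner (tilt 0) (tilt \<delta>) (tilt \<epsilon>) = 1 + \<delta> * \<epsilon> + (\<delta> * \<epsilon>)\<^sup>2 / 3"
proof -
  have v: "pmf (tilt \<delta>) 2 = (1 + \<delta>)\<^sup>2 / 8" "pmf (tilt \<delta>) (- 2) = (1 - \<delta>)\<^sup>2 / 8"
    "pmf (tilt \<delta>) 0 = 1 - (1 + \<delta>)\<^sup>2 / 8 - (1 - \<delta>)\<^sup>2 / 8" if "\<bar>\<delta>\<bar> \<le> 1" for \<delta>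
    by (simp_all add: pmf_tilt[OF that])
  have v0: "pmf (tilt 0) 2 = 1 / 8" "pmf (tilt 0) (- 2) = 1 / 8" "pmf (tilt 0) 0 = 3 / 4"
    by (simp_all add: pmf_tilt)
  have "lr_inner (tilt 0) (tilt \<delta>) (tilt \<epsilon>) =
      (1 + \<delta>)\<^sup>2 / 8 * ((1 + \<epsilon>)\<^sup>2 / 8) / (1 / 8) + ((1 - \<delta>)\<^sup>2 / 8 * ((1 - \<epsilon>)\<^sup>2 / 8) / (1 / 8) +
      (1 - (1 + \<delta>)\<^sup>2 / 8 - (1 - \<delta>)\<^sup>2 / 8) * (1 - (1 + \<epsilon>)\<^sup>2 / 8 - (1 - \<epsilon>)\<^sup>2 / 8) / (3 / 4))"
    by (simp add: v0 lr_inner_def set_pmf_tilt_0 v[OF assms(1)] v[OF assms(2)])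
  also have "\<dots> = 1 + \<delta> * \<epsilon> + (\<delta> * \<epsilon>)\<^sup>2 / 3"
    by (simp add: power2_eq_square algebra_simps add_divide_distrib diff_divide_distrib)
  finally show ?thesis .
qed

section \<open>Summing the correlations over a geometric grid\<close>

lemma sum_half_power_le_2:
  assumes "finite A" "inj_on g A"
  shows "(\<Sum>j\<in>A. (1 / 2 :: real) ^ g j) \<le> 2"
proof -
  have "(\<Sum>j\<in>A. (1 / 2 :: real) ^ g j) = (\<Sum>d\<in>g ` A. (1 / 2) ^ d)"
    using assms by (simp add: sum.reindex)
  also have "\<dots> \<le> (\<Sum>d. (1 / 2) ^ d)"
    using assms by (intro sum_le_suminf) (auto intro: summable_geometric)
  also have "\<dots> = 2"
    by (subst suminf_geometric) auto
  finally show ?thesis .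
qed

text \<open>By convexity, exp lies below its chord between 0 and \<beta>.\<close>

lemma exp_mult_le:
  assumes "0 \<le> r" "r \<le> (1 :: real)"
  shows "exp (\<beta> * r) \<le> 1 + r * (exp \<beta> - 1)"
  using convex_onD[OF exp_convex, of r 0 \<beta>] assms by (simp add: algebra_simps)

text \<open>With truncated subtraction, \<open>(i - j) + (j - i)\<close> is the distance of
  \<open>i\<close> and \<open>j\<close>. By convexity a term exceeds 1 by at most its power of 1/2
  times \<open>exp \<beta> - 1\<close>. The powers sum to at most 2 on either side of
  \<open>i\<close>, so the excess of a row of the sum is at most 4/64 = 1/16 per grid point.\<close>

lemma sum_exp_half_power_le:
  assumes A: "finite A" and "\<beta> \<ge> 0" and \<beta>: "exp \<beta> \<le> 1 + real (card A) / 64"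
  shows "(\<Sum>i\<in>A. \<Sum>j\<in>A. exp (\<beta> * (1 / 2) ^ ((i - j) + (j - i)))) \<le> 17 / 16 * (real (card A))\<^sup>2"
proof -
  have S: "(\<Sum>j\<in>A. exp (\<beta> * (1 / 2) ^ ((i - j) + (j - i)))) \<le> real (card A) * (17 / 16)" for i
  proof -
    have "(\<Sum>j\<in>A. (1 / 2 :: real) ^ ((i - j) + (j - i))) =
        (\<Sum>j\<in>{j\<in>A. j \<le> i}. (1 / 2) ^ ((i - j) + (j - i))) + (\<Sum>j\<in>{j\<in>A. \<not> j \<le> i}. (1 / 2) ^ ((i - j) + (j - i)))"
      using A by (subst sum.union_disjoint[symmetric]) (auto intro!: sum.cong)
    also have "\<dots> \<le> 2 + 2"
      using A by (intro add_mono sum_half_power_le_2) (auto simp: inj_on_def)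
    finally have 4: "(\<Sum>j\<in>A. (1 / 2 :: real) ^ ((i - j) + (j - i))) \<le> 4" by simp
    have "(\<Sum>j\<in>A. exp (\<beta> * (1 / 2) ^ ((i - j) + (j - i))))
        \<le> (\<Sum>j\<in>A. 1 + (1 / 2) ^ ((i - j) + (j - i)) * (exp \<beta> - 1))"
      by (intro sum_mono exp_mult_le) (auto intro: power_le_one)
    also have "\<dots> = real (card A) + (\<Sum>j\<in>A. (1 / 2) ^ ((i - j) + (j - i))) * (exp \<beta> - 1)"
      by (simp add: sum.distrib sum_distrib_right)
    also have "\<dots> \<le> real (card A) + 4 * (real (card A) / 64)"
      using 4 \<beta> \<open>\<beta> \<ge> 0\<close> by (intro add_left_mono mult_mono) auto
    finally show ?thesis by (simp add: field_simps)
  qed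
  have "(\<Sum>i\<in>A. \<Sum>j\<in>A. exp (\<beta> * (1 / 2) ^ ((i - j) + (j - i)))) \<le> (\<Sum>i\<in>A. real (card A) * (17 / 16))"
    by (intro sum_mono S)
  then show ?thesis by (simp add: power2_eq_square mult_ac)
qed

text \<open>The left side is the correlation of two alternatives: the number of columns shifted in
  both, times shifts proportional to 2^(-i) and 2^(-j).\<close>

lemma min_powers_4:
  "real (min (4 ^ i) (4 ^ j)) / (2 ^ i * 2 ^ j) = (1 / 2) ^ ((i - j) + (j - i))"
proof -
  have *: "real (4 ^ i) / (2 ^ i * 2 ^ (i + d)) = (1 / 2) ^ d" for i d
  proof -
    have "real (4 ^ i) = (2 * 2) ^ i" by simp
    also have "\<dots> = 2 ^ i * 2 ^ i" by (rule power_mult_distrib)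
    finally show ?thesis by (simp only:) (simp add: power_add power_divide)
  qed
  show ?thesis
  proof (cases "i \<le> j")
    case True
    then obtain d where "j = i + d" using le_Suc_ex by blast
    moreover have "min (4 ^ i) (4 ^ (i + d)) = (4 ^ i :: nat)"
      by (intro min_absorb1 power_increasing) auto
    ultimately show ?thesis using *[of i d] by simp
  next
    case False
    then obtain d where "i = j + d" by (metis le_Suc_ex nat_le_linear)
    moreover have "min (4 ^ (j + d)) (4 ^ j) = (4 ^ j :: nat)"
      by (intro min_absorb2 power_increasing) auto
    ultimately show ?thesis using *[of j d] by (simp add: mult.commute)
  qed
qed

text \<open>
  With shifts \<open>\<plusminus> A / 2 ^ j\<close> before the change point \<open>4 ^ j\<close>, the alternatives \<open>i\<close> and \<open>j\<close> have
  correlation decaying like \<open>2 ^ - \<bar>i - j\<bar>\<close>, so they act like about \<open>m\<close> nearly orthogonal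
  alternatives: this is the source of the iterated logarithm.
\<close>

lemma minimax_risk_ge_half_grid:
  assumes "\<alpha> \<ge> 0" "K \<ge> 16" "p \<ge> 1"
  assumes m: "2 * 4 ^ (2 * m) \<le> n"
  assumes A: "0 \<le> A" "A\<^sup>2 \<le> 4 ^ m"
  assumes lab: "\<And>i. set_pmf (lab i) \<subseteq> {-1, 0, 1}"
  assumes good: "measure (Pi_pmf {1..p} 0 lab)
      {y. l0_norm p y \<le> s \<and> \<rho>\<^sup>2 \<le> A\<^sup>2 / 2 * real (l0_norm p y)} \<ge> 3 / 4"
  assumes "\<beta> \<ge> 0" and \<beta>: "exp \<beta> \<le> 1 + real (m + 1) / 64"
  assumes chi: "\<And>T r x. T \<ge> 1 \<Longrightarrow> 0 \<le> r \<Longrightarrow> r \<le> 1 \<Longrightarrow> real T * x = A\<^sup>2 * r \<Longrightarrow>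
      (\<Prod>i\<in>{1..p}. measure_pmf.expectation (lab i) (\<lambda>y. measure_pmf.expectation (lab i) (\<lambda>z.
          (1 + y * z * x + (y * z * x)\<^sup>2 / 3) ^ T))) \<le> exp (\<beta> * r)"
  shows "minimax_risk \<alpha> K p n s \<rho> \<ge> 1 / 2"
proof -
  \<comment> \<open>The lower end of the exponents together with
    \<open>A\<^sup>2 \<le> 4 ^ m\<close> keeps the shifts at most 1; the upper end keeps the change
    points at most n/2. This leaves m + 1 grid points.\<close>
  define G :: "nat set" where "G = (\<lambda>j. 4 ^ j) ` {m..2*m}"
  define a where "a k = A / sqrt (real k)" for k
  define d where "d k y t = tilt (if t \<le> k then y * a k else 0)" for k y and t :: nat
  have inj: "inj_on (\<lambda>j. 4 ^ j :: nat) X" for X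
    by (auto simp: inj_on_def)
  have sq: "sqrt (real (4 ^ j)) = 2 ^ j" for j
    by (simp add: real_sqrt_power)
  have aj: "a (4 ^ j) = A / 2 ^ j" for j
    by (simp only: a_def sq)
  have G: "k \<ge> 1" "2 * k \<le> n" "0 \<le> a k" "a k \<le> 1" "real k * (a k)\<^sup>2 = A\<^sup>2" if "k \<in> G" for k
  proof -
    obtain j where j: "j \<in> {m..2*m}" "k = 4 ^ j" using \<open>k \<in> G\<close> by (auto simp: G_def)
    show "k \<ge> 1" using j by simp
    have "k \<le> 4 ^ (2 * m)" unfolding j(2) using j(1) by (intro power_increasing) auto
    then show "2 * k \<le> n" using m by linarith
    show "0 \<le> a k" using A by (simp add: a_def)
    show "real k * (a k)\<^sup>2 = A\<^sup>2" using \<open>k \<ge> 1\<close> by (simp add: a_def power_divide)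
    have "(4::real) ^ m \<le> 4 ^ j" using j(1) by (intro power_increasing) auto
    then have "A\<^sup>2 \<le> real k" unfolding j(2) of_nat_power using A by (simp only: of_nat_numeral)
    then have "A \<le> sqrt (real k)" by (rule real_le_rsqrt)
    then show "a k \<le> 1" using \<open>k \<ge> 1\<close> by (simp add: a_def)
  qed
  have bd: "\<bar>if t \<le> k then y * a k else 0\<bar> \<le> 1" if "k \<in> G" "y \<in> {-1, 0, 1}" for k y and t :: nat
    using G[OF that(1)] that(2) by auto
  \<comment> \<open>Only columns shifted under both alternatives contribute; elsewhere the inner
    product is 1.\<close>
  have prodt: "(\<Prod>t\<in>{1..n}. lr_inner (tilt 0) (d k y t) (d l z t)) =
      (1 + y * z * (a k * a l) + (y * z * (a k * a l))\<^sup>2 / 3) ^ min k l"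
    if "k \<in> G" "l \<in> G" "y \<in> {-1, 0, 1}" "z \<in> {-1, 0, 1}" for k l y z
  proof -
    have "(\<Prod>t\<in>{1..n}. lr_inner (tilt 0) (d k y t) (d l z t)) =
        (\<Prod>t\<in>{1..n}. if t \<le> min k l then 1 + y * z * (a k * a l) + (y * z * (a k * a l))\<^sup>2 / 3 else 1)"
    proof (rule prod.cong[OF refl])
      fix t
      have "lr_inner (tilt 0) (d k y t) (d l z t) =
          1 + (if t \<le> k then y * a k else 0) * (if t \<le> l then z * a l else 0) +
          ((if t \<le> k then y * a k else 0) * (if t \<le> l then z * a l else 0))\<^sup>2 / 3"
        unfolding d_def using bd that by (intro lr_inner_tilt)
      then show "lr_inner (tilt 0) (d k y t) (d l z t) =
          (if t \<le> min k l then 1 + y * z * (a k * a l) + (y * z * (a k * a l))\<^sup>2 / 3 else 1)"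
        by (simp add: mult_ac)
    qed
    also have "\<dots> = (1 + y * z * (a k * a l) + (y * z * (a k * a l))\<^sup>2 / 3) ^ card {t\<in>{1..n}. t \<le> min k l}"
      by (simp add: prod.If_cases Int_def)
    also have "{t\<in>{1..n}. t \<le> min k l} = {1..min k l}"
      using G[OF that(1)] by auto
    finally show ?thesis by simp
  qed
  show ?thesis
  proof (rule minimax_risk_ge_half_of_prior[where G = G and lab = lab and a = a and d = d and q = "\<lambda>_. tilt 0"])
    show "n \<ge> 1" using m by (metis One_nat_def Suc_leI gr_zeroI mult_is_0 not_le power_not_zero zero_less_numeral zero_neq_numeral le_zero_eq)
    show "G \<subseteq> {1..n-1}"
      using G by force
    show "noise_pmf \<alpha> K 0 (tilt 0)" using assms by (intro noise_pmf_tilt) auto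
    show "noise_pmf \<alpha> K (if t \<le> k then y * a k else 0) (d k y t)" if "k \<in> G" "y \<in> {-1, 0, 1}" for k y t
      unfolding d_def using bd[OF that] assms by (intro noise_pmf_tilt) auto
    show "set_pmf (d k y t) \<subseteq> set_pmf (tilt 0)" if "k \<in> G" "y \<in> {-1, 0, 1}" for k y t
      unfolding d_def set_pmf_tilt_0 using bd[OF that] by (rule set_pmf_tilt)
    have "\<rho>\<^sup>2 \<le> real k * (real n - real k) / real n * ((a k)\<^sup>2 * l)"
      if "k \<in> G" "\<rho>\<^sup>2 \<le> A\<^sup>2 / 2 * l" "l \<ge> 0" for k and l :: real
    proof -
      have "A\<^sup>2 / 2 * l = 1 / 2 * (real k * (a k)\<^sup>2 * l)"
        using G(5)[OF that(1)] by simp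
      \<comment> \<open>Since the change point is at most n/2, the factor (n - k)/n is at least
        1/2.\<close>
      also have "\<dots> \<le> (real n - real k) / real n * (real k * (a k)\<^sup>2 * l)"
        using G(1,2)[OF that(1)] that(3) by (intro mult_right_mono) (auto simp: field_simps)
      also have "\<dots> = real k * (real n - real k) / real n * ((a k)\<^sup>2 * l)"
        by simp
      finally show ?thesis by (rule order.trans[OF that(2)])
    qed
    then show "3 / 4 \<le> measure (Pi_pmf {1..p} 0 lab) {y. l0_norm p y \<le> s \<and>
       (\<forall>k\<in>G. \<rho>\<^sup>2 \<le> real k * (real n - real k) / real n * ((a k)\<^sup>2 * l0_norm p y))}"
      by (intro order.trans[OF good] measure_pmf.finite_measure_mono) auto
    have E: "(\<Prod>i\<in>{1..p}. measure_pmf.expectation (lab i) (\<lambda>y. measure_pmf.expectation (lab i) (\<lambda>z.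
          \<Prod>t\<in>{1..n}. lr_inner (tilt 0) (d (4 ^ i') y t) (d (4 ^ j') z t))))
        \<le> exp (\<beta> * (1 / 2) ^ ((i' - j') + (j' - i')))" if "i' \<in> {m..2*m}" "j' \<in> {m..2*m}" for i' j'
    proof -
      let ?k = "4 ^ i' :: nat" and ?l = "4 ^ j' :: nat"
      have kl: "?k \<in> G" "?l \<in> G" using that by (auto simp: G_def)
      have "(\<Prod>i\<in>{1..p}. measure_pmf.expectation (lab i) (\<lambda>y. measure_pmf.expectation (lab i) (\<lambda>z.
          \<Prod>t\<in>{1..n}. lr_inner (tilt 0) (d ?k y t) (d ?l z t)))) =
        (\<Prod>i\<in>{1..p}. measure_pmf.expectation (lab i) (\<lambda>y. measure_pmf.expectation (lab i) (\<lambda>z.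
          (1 + y * z * (a ?k * a ?l) + (y * z * (a ?k * a ?l))\<^sup>2 / 3) ^ min ?k ?l)))"
      proof (intro prod.cong refl integral_cong_AE)
        fix i
        show "AE y in lab i. measure_pmf.expectation (lab i) (\<lambda>z.
            \<Prod>t\<in>{1..n}. lr_inner (tilt 0) (d ?k y t) (d ?l z t)) =
          measure_pmf.expectation (lab i) (\<lambda>z.
            (1 + y * z * (a ?k * a ?l) + (y * z * (a ?k * a ?l))\<^sup>2 / 3) ^ min ?k ?l)"
          unfolding AE_measure_pmf_iff
        proof (intro ballI integral_cong_AE)
          fix y assume "y \<in> set_pmf (lab i)"
          then show "AE z in lab i. (\<Prod>t\<in>{1..n}. lr_inner (tilt 0) (d ?k y t) (d ?l z t)) =
              (1 + y * z * (a ?k * a ?l) + (y * z * (a ?k * a ?l))\<^sup>2 / 3) ^ min ?k ?l"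
            using lab[of i] by (intro AE_pmfI prodt[OF kl]) blast+
        qed simp_all
      qed simp_all
      also have "\<dots> \<le> exp (\<beta> * (1 / 2) ^ ((i' - j') + (j' - i')))"
      proof (rule chi)
        show "real (min ?k ?l) * (a ?k * a ?l) = A\<^sup>2 * (1 / 2) ^ ((i' - j') + (j' - i'))"
          unfolding min_powers_4[symmetric] aj by (simp add: power2_eq_square)
      qed (auto intro: power_le_one)
      finally show ?thesis .
    qed
    have "(\<Sum>k\<in>G. \<Sum>l\<in>G. \<Prod>i\<in>{1..p}. measure_pmf.expectation (lab i) (\<lambda>y. measure_pmf.expectation (lab i) (\<lambda>z.
          \<Prod>t\<in>{1..n}. lr_inner (tilt 0) (d k y t) (d l z t)))) \<le>
        (\<Sum>i\<in>{m..2*m}. \<Sum>j\<in>{m..2*m}. exp (\<beta> * (1 / 2) ^ ((i - j) + (j - i))))"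
      unfolding G_def sum.reindex[OF inj] comp_def by (intro sum_mono E)
    also have "\<dots> \<le> 17 / 16 * (real (card {m..2*m}))\<^sup>2"
      using \<beta> \<open>\<beta> \<ge> 0\<close> by (intro sum_exp_half_power_le) auto
    also have "card {m..2*m} = card G"
      unfolding G_def by (rule card_image[OF inj, symmetric])
    finally show "(\<Sum>k\<in>G. \<Sum>l\<in>G. \<Prod>i\<in>{1..p}. measure_pmf.expectation (lab i) (\<lambda>y. measure_pmf.expectation (lab i) (\<lambda>z.
          \<Prod>t\<in>{1..n}. lr_inner (tilt 0) (d k y t) (d l z t)))) \<le> 17 / 16 * (real (card G))\<^sup>2" .
  qed (use assms in \<open>auto simp: G_def\<close>)
qed

section \<open>The number of shifted rows and the size of the grid\<close>

lemma exp_half_le: "exp (1 / 2 :: real) \<le> 165 / 100"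
proof -
  have "(exp (1 / 2 :: real))\<^sup>2 = exp 1"
    by (simp add: power2_eq_square exp_add[symmetric])
  then have "(exp (1 / 2 :: real))\<^sup>2 \<le> (165 / 100)\<^sup>2"
    using e_less_272 by (simp add: power2_eq_square)
  then show ?thesis
    by (rule power2_le_imp_le) simp
qed

text \<open>A label is nonzero with probability s/(2p), so the mean number of nonzero labels is s/2.
  Chernoff bounds with exponents 1/2 and -1/2 control the events of at least \<open>s\<close> and at
  most s/4 nonzero labels. For s at least 100 their probabilities are at most 1/18 and 1/7, together
  below 1/4.\<close>

lemma prob_l0_norm_labels:
  assumes p: "p \<ge> 1" and s: "100 \<le> s" "s \<le> p" and u: "u = real s / (4 * real p)"
  shows "measure (Pi_pmf {1..p} 0 (\<lambda>_. three 1 u u))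
      {y. l0_norm p y \<le> s \<and> real s / 4 \<le> real (l0_norm p y)} \<ge> 3 / 4"
proof -
  let ?L = "Pi_pmf {1..p} (0::real) (\<lambda>_. three 1 u u)"
  let ?N = "\<lambda>y. real (l0_norm p y)"
  have "real s \<le> real p" using s by simp
  then have u01: "0 \<le> u" "u + u \<le> 1"
    using p by (auto simp: u field_simps)
  note E3 = expectation_three[OF zero_less_one u01(1) u01(1) u01(2)]
  note fin3 = finite_set_pmf_three[OF zero_less_one u01(1) u01(1) u01(2)]
  have finL: "finite (set_pmf ?L)"
    by (simp add: set_Pi_pmf finite_PiE_dflt fin3)
  note int = integrable_measure_pmf_finite[OF finL]
  have mgf: "measure_pmf.expectation ?L (\<lambda>y. exp (\<theta> * ?N y)) \<le> exp (real s / 2 * (exp \<theta> - 1))" for \<theta>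
  proof -
    have "exp (\<theta> * ?N y) = (\<Prod>i\<in>{1..p}. if y i \<noteq> 0 then exp \<theta> else 1)" for y
      by (simp add: l0_norm_def prod.If_cases Int_def exp_of_nat_mult[symmetric] mult.commute)
    then have "measure_pmf.expectation ?L (\<lambda>y. exp (\<theta> * ?N y)) =
        (\<Prod>i\<in>{1..p}. measure_pmf.expectation (three 1 u u) (\<lambda>v. if v \<noteq> 0 then exp \<theta> else 1))"
      using expectation_prod_Pi_pmf[of "{1..p}" "\<lambda>_. three 1 u u" "\<lambda>_ v. if v \<noteq> 0 then exp \<theta> else 1" 0]
      by (simp add: integrable_measure_pmf_finite fin3)
    also have "\<dots> = (1 + 2 * u * (exp \<theta> - 1)) ^ p"
      by (simp add: E3 algebra_simps)
    also have "\<dots> \<le> exp (2 * u * (exp \<theta> - 1)) ^ p"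
    proof (rule power_mono[OF exp_ge_add_one_self])
      have "- 1 \<le> 2 * u * (- 1)" using u01 by simp
      also have "\<dots> \<le> 2 * u * (exp \<theta> - 1)"
        using u01 by (intro mult_left_mono) auto
      finally show "0 \<le> 1 + 2 * u * (exp \<theta> - 1)" by simp
    qed
    also have "\<dots> = exp (real s / 2 * (exp \<theta> - 1))"
      using p by (simp add: exp_of_nat_mult[symmetric] u)
    finally show ?thesis .
  qed
  \<comment> \<open>The event is written so that the sign of \<theta> selects the upper or the lower
    tail.\<close>
  have markov: "measure ?L {y. 0 \<le> \<theta> * ?N y - b} \<le> exp (real s / 2 * (exp \<theta> - 1) - b)" for \<theta> b
  proof -
    have "measure ?L {y. 0 \<le> \<theta> * ?N y - b} =
        measure_pmf.expectation ?L (indicator {y. 0 \<le> \<theta> * ?N y - b})"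
      by simp
    also have "\<dots> \<le> measure_pmf.expectation ?L (\<lambda>y. exp (\<theta> * ?N y) * exp (- b))"
      by (intro integral_mono int) (auto simp: indicator_def exp_add[symmetric])
    also have "\<dots> \<le> exp (real s / 2 * (exp \<theta> - 1)) * exp (- b)"
      using mgf by simp
    also have "\<dots> = exp (real s / 2 * (exp \<theta> - 1) - b)"
      by (simp only: exp_add[symmetric] diff_conv_add_uminus)
    finally show ?thesis .
  qed
  have s100: "real s \<ge> 100" using s by simp
  have "13 / 8 \<le> exp (1 / 2 :: real)"
    using exp_lower_Taylor_quadratic[of "1 / 2"] by (simp add: power2_eq_square)
  then have "exp (- (1 / 2) :: real) \<le> 1 / (13 / 8)"
    unfolding exp_minus inverse_eq_divide by (intro divide_left_mono) auto
  then have e2: "exp (- (1 / 2) :: real) \<le> 8 / 13" by simp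
  have exp_neg: "exp (- x) \<le> 1 / (1 + x)" if "x \<ge> 0" for x :: real
    using that exp_ge_add_one_self[of x] unfolding exp_minus inverse_eq_divide
    by (intro divide_left_mono) auto
  have hi: "measure ?L {y. 0 \<le> 1 / 2 * ?N y - real s / 2} \<le> 1 / 18"
  proof -
    have "real s / 2 * (exp (1 / 2) - 1) \<le> real s / 2 * (65 / 100)"
      using exp_half_le by (intro mult_left_mono) auto
    then have "real s / 2 * (exp (1 / 2) - 1) - real s / 2 \<le> - 17"
      using s100 by linarith
    then have "exp (real s / 2 * (exp (1 / 2) - 1) - real s / 2) \<le> exp (- 17)"
      by simp
    also have "\<dots> \<le> 1 / 18" using exp_neg[of 17] by simp
    finally show ?thesis by (rule order.trans[OF markov])
  qed
  have lo: "measure ?L {y. 0 \<le> - (1 / 2) * ?N y - - (real s / 8)} \<le> 1 / 7"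
  proof -
    have "real s / 2 * (exp (- (1 / 2)) - 1) \<le> real s / 2 * (- (5 / 13))"
      using e2 by (intro mult_left_mono) auto
    then have "real s / 2 * (exp (- (1 / 2)) - 1) - - (real s / 8) \<le> - 6"
      using s100 by linarith
    then have "exp (real s / 2 * (exp (- (1 / 2)) - 1) - - (real s / 8)) \<le> exp (- 6)"
      by simp
    also have "\<dots> \<le> 1 / 7" using exp_neg[of 6] by simp
    finally show ?thesis by (rule order.trans[OF markov])
  qed
  let ?B = "{y. l0_norm p y \<le> s \<and> real s / 4 \<le> ?N y}"
  have "measure ?L (- ?B) \<le> measure ?L ({y. 0 \<le> 1 / 2 * ?N y - real s / 2} \<union> {y. 0 \<le> - (1 / 2) * ?N y - - (real s / 8)})"
    by (intro measure_pmf.finite_measure_mono) auto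
  also have "\<dots> \<le> 1 / 18 + 1 / 7"
    using hi lo by (intro order.trans[OF measure_Un_le] add_mono) auto
  finally have "measure ?L (- ?B) \<le> 1 / 4" by simp
  then show ?thesis
    using measure_pmf.prob_compl[of ?B ?L] by (simp add: Compl_eq_Diff_UNIV)
qed

text \<open>Take the largest m with 2 * 16^m at most n. The m + 1 grid points then number at least a
  constant times log n, while the largest change point 4^(2m) is at most n/2.\<close>

lemma ex_scale:
  assumes "n \<ge> 2"
  obtains m :: nat where "2 * 4 ^ (2 * m) \<le> n" "ln (8 * real n) \<le> 6 * real (m + 1)"
proof -
  define k where "k = (LEAST k. n < 2 * 16 ^ k)"
  have ex: "\<exists>k. n < 2 * 16 ^ k"
  proof
    have "n < 2 ^ n" by (rule less_exp)
    also have "(2::nat) ^ n \<le> 16 ^ n" by (rule power_mono) auto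
    also have "\<dots> \<le> 2 * 16 ^ n" by simp
    finally show "n < 2 * 16 ^ n" .
  qed
  have k: "n < 2 * 16 ^ k"
    unfolding k_def using ex by (rule LeastI_ex)
  have "k \<noteq> 0" using k assms by (intro notI) simp
  then obtain m where m: "k = Suc m" using not0_implies_Suc by blast
  have "\<not> n < 2 * 16 ^ m"
    using not_less_Least[of m "\<lambda>k. n < 2 * 16 ^ k"] m by (simp add: k_def)
  then have "2 * 4 ^ (2 * m) \<le> n"
    by (simp add: power_mult)
  moreover have "ln (8 * real n) \<le> 6 * real (m + 1)"
  proof -
    have "real n < real (2 * 16 ^ k)" using k by (simp only: of_nat_less_iff)
    then have "8 * real n \<le> 2 ^ 4 * 16 ^ k" by simp
    also have "\<dots> = 2 ^ (4 * (k + 1))" by (simp add: power_add power_mult)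
    finally have "ln (8 * real n) \<le> ln (2 ^ (4 * (k + 1)))"
      using assms by (subst ln_le_cancel_iff) auto
    also have "\<dots> = real (4 * (k + 1)) * ln 2" by (simp only: ln_realpow)
    also have "\<dots> \<le> real (4 * (k + 1)) * (3 / 4)"
      using ln2_le_25_over_36 by (intro mult_left_mono) auto
    also have "\<dots> \<le> 6 * real (m + 1)" by (simp add: m)
    finally show ?thesis .
  qed
  ultimately show ?thesis by (rule that)
qed

text \<open>For n at least 2 the inner logarithm is at least 4 log 2, which exceeds
  exp(1/2).\<close>

lemma loglog_ge_half:
  assumes "n \<ge> 2"
  shows "1 / 2 \<le> ln (ln (8 * real n))"
proof -
  have "exp (1 / 2) \<le> 4 * ln (2 :: real)"
    using ln2_ge_two_thirds exp_half_le by simp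
  also have "\<dots> = ln (2 ^ 4)" by (subst ln_realpow) auto
  also have "\<dots> \<le> ln (8 * real n)"
    using assms by (subst ln_le_cancel_iff) auto
  finally have le: "exp (1 / 2) \<le> ln (8 * real n)" .
  moreover have "0 < ln (8 * real n)"
    using le by (rule less_le_trans[OF exp_gt_zero])
  ultimately show ?thesis by (simp only: ln_ge_iff)
qed

text \<open>This turns a small multiple of log log n into an admissible exponent \<beta> for the
  grid. Convexity bounds the exponential by 1 + \<epsilon> log(8n), and 6/384 = 1/64.\<close>

lemma exp_scaled_loglog_le:
  assumes "n \<ge> 2" "0 \<le> \<epsilon>" "\<epsilon> \<le> 1 / 384" "ln (8 * real n) \<le> 6 * real (m + 1)"
  shows "exp (\<epsilon> * ln (ln (8 * real n))) \<le> 1 + real (m + 1) / 64"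
proof -
  have "2 / 3 \<le> ln (2 :: real)" by (rule ln2_ge_two_thirds)
  also have "\<dots> \<le> ln (8 * real n)" using assms by (subst ln_le_cancel_iff) auto
  finally have pos: "0 < ln (8 * real n)" by simp
  have "exp (ln (ln (8 * real n)) * \<epsilon>) \<le> 1 + \<epsilon> * (exp (ln (ln (8 * real n))) - 1)"
    using assms by (intro exp_mult_le) auto
  also have "\<dots> \<le> 1 + \<epsilon> * (6 * real (m + 1))"
    using assms pos by (intro add_left_mono mult_left_mono) auto
  also have "\<dots> \<le> 1 + 1 / 384 * (6 * real (m + 1))"
    using assms by (intro add_left_mono mult_right_mono) auto
  also have "\<dots> = 1 + real (m + 1) / 64" by simp
  finally show ?thesis by (simp only: mult.commute)
qed

text \<open>Only row 1 is shifted, with the deterministic label 1. The factor 2 in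
  \<open>A\<^sup>2 = 2 * \<rho>\<^sup>2\<close> pays for (n - k)/n being only at least 1/2. A shared
  column contributes 1 + x + x^2/3, at most exp x, so the grid bound holds with \<beta> =
  A^2.\<close>

lemma minimax_risk_ge_half_one_coordinate:
  assumes "\<alpha> \<ge> 0" "K \<ge> 16" "p \<ge> 1" "s \<ge> 1" and n: "n \<ge> 2"
    and \<rho>: "\<rho>\<^sup>2 \<le> ln (ln (8 * real n)) / 1000"
  shows "minimax_risk \<alpha> K p n s \<rho> \<ge> 1 / 2"
proof -
  define L where "L = ln (ln (8 * real n))"
  obtain m where m: "2 * 4 ^ (2 * m) \<le> n" "ln (8 * real n) \<le> 6 * real (m + 1)"
    using n by (rule ex_scale)
  define A where "A = sqrt (2 * \<rho>\<^sup>2)"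
  have A2: "A\<^sup>2 = 2 * \<rho>\<^sup>2" by (simp add: A_def)
  have pos: "0 < ln (8 * real n)" using n by simp
  define lab :: "nat \<Rightarrow> real pmf" where "lab i = return_pmf (if i = 1 then 1 else 0)" for i
  show ?thesis
  proof (rule minimax_risk_ge_half_grid[where A = A and \<beta> = "A\<^sup>2" and m = m and lab = lab])
    show "A\<^sup>2 \<le> 4 ^ m"
    proof -
      have "A\<^sup>2 \<le> L / 500" using \<rho> by (simp add: A2 L_def)
      also have "L \<le> ln (8 * real n) - 1"
        unfolding L_def using pos by (rule ln_le_minus_one)
      also have "\<dots> \<le> 6 * real (m + 1)" using m by simp
      also have "real (m + 1) \<le> 4 ^ m"
        by (induction m) auto
      finally have "A\<^sup>2 \<le> 3 / 250 * 4 ^ m" by simp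
      also have "\<dots> \<le> 1 * 4 ^ m" by (rule mult_right_mono) auto
      finally show ?thesis by simp
    qed
    have "exp (A\<^sup>2) \<le> exp (1 / 500 * L)" using \<rho> by (simp add: A2 L_def)
    also have "\<dots> \<le> 1 + real (m + 1) / 64"
      unfolding L_def using n m by (intro exp_scaled_loglog_le) auto
    finally show "exp (A\<^sup>2) \<le> 1 + real (m + 1) / 64" .
    have "l0_norm p (\<lambda>i. if i \<in> {1..p} then if i = 1 then 1 else 0 else 0) = 1"
    proof -
      have "{i \<in> {1..p}. (if i \<in> {1..p} then if i = 1 then 1 else (0::real) else 0) \<noteq> 0} = {1}"
        using \<open>p \<ge> 1\<close> by (auto split: if_splits)
      then show ?thesis by (simp only: l0_norm_def) simp
    qed
    then show "3 / 4 \<le> measure (Pi_pmf {1..p} 0 lab)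
        {y. l0_norm p y \<le> s \<and> \<rho>\<^sup>2 \<le> A\<^sup>2 / 2 * real (l0_norm p y)}"
      using \<open>s \<ge> 1\<close> unfolding lab_def
      by (subst Pi_pmf_return_pmf) (auto simp: A2 measure_return_pmf indicator_def)
    fix T :: nat and r x :: real
    assume T: "T \<ge> 1" and r: "0 \<le> r" "r \<le> 1" and x: "real T * x = A\<^sup>2 * r"
    have "0 \<le> real T * x" using r by (simp add: x)
    then have x0: "0 \<le> x" using T by (simp add: zero_le_mult_iff)
    have "(\<Prod>i\<in>{1..p}. measure_pmf.expectation (lab i) (\<lambda>y. measure_pmf.expectation (lab i) (\<lambda>z.
        (1 + y * z * x + (y * z * x)\<^sup>2 / 3) ^ T))) = (\<Prod>i\<in>{1..p}. if i = 1 then (1 + x + x\<^sup>2 / 3) ^ T else 1)"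
      by (intro prod.cong refl) (simp add: lab_def integral_measure_pmf_real[of "{1}"] integral_measure_pmf_real[of "{0}"])
    also have "\<dots> = (1 + x + x\<^sup>2 / 3) ^ T"
      using \<open>p \<ge> 1\<close> by (simp add: prod.delta)
    also have "\<dots> \<le> exp x ^ T"
      using exp_lower_Taylor_quadratic[OF x0] x0
      by (intro power_mono) (auto intro: order.trans[rotated])
    also have "\<dots> = exp (A\<^sup>2 * r)"
      by (simp add: exp_of_nat_mult[symmetric] x)
    finally show "(\<Prod>i\<in>{1..p}. measure_pmf.expectation (lab i) (\<lambda>y. measure_pmf.expectation (lab i) (\<lambda>z.
        (1 + y * z * x + (y * z * x)\<^sup>2 / 3) ^ T))) \<le> exp (A\<^sup>2 * r)" .
  qed (use assms m in \<open>auto simp: lab_def A_def\<close>)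
qed

section \<open>Random signs over the grid\<close>

lemma exp_average_le:
  assumes "0 \<le> y" "y \<le> (1 / 2 :: real)"
  shows "(exp (y + y\<^sup>2 / 3) + exp (- y + y\<^sup>2 / 3)) / 2 \<le> 1 + 2 * y\<^sup>2"
proof -
  \<comment> \<open>The linear terms of the two bounds cancel in the average, which leaves a
    quadratic effect.\<close>
  have "exp y \<le> 1 + y + y\<^sup>2"
    using assms by (intro exp_bound) auto
  moreover have "exp (- y) \<le> 1 - y + y\<^sup>2"
  proof -
    have "1 \<le> 1 + y\<^sup>2 / 2 + y ^ 3 / 2 + y ^ 4 / 2" using assms by simp
    also have "\<dots> = (1 - y + y\<^sup>2) * (1 + y + y\<^sup>2 / 2)"
      by (simp add: algebra_simps power2_eq_square power3_eq_cube power4_eq_xxxx add_divide_distrib diff_divide_distrib)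
    also have "\<dots> \<le> (1 - y + y\<^sup>2) * exp y"
      using exp_lower_Taylor_quadratic[of y] assms by (intro mult_left_mono) auto
    finally show ?thesis by (simp add: exp_minus field_simps)
  qed
  ultimately have "(exp y + exp (- y)) / 2 \<le> 1 + y\<^sup>2" by simp
  also have "\<dots> \<le> exp (y\<^sup>2)" by (rule exp_ge_add_one_self)
  finally have "(exp y + exp (- y)) / 2 * exp (y\<^sup>2 / 3) \<le> exp (y\<^sup>2) * exp (y\<^sup>2 / 3)"
    by (rule mult_right_mono) simp
  also have "\<dots> = exp (4 / 3 * y\<^sup>2)"
    by (simp add: exp_add[symmetric])
  also have "\<dots> \<le> 1 + 4 / 3 * y\<^sup>2 + (4 / 3 * y\<^sup>2)\<^sup>2"
  proof (rule exp_bound)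
    have "y\<^sup>2 \<le> (1 / 2)\<^sup>2" using assms by (intro power_mono) auto
    then show "4 / 3 * y\<^sup>2 \<le> 1" by (simp add: power2_eq_square)
  qed simp
  also have "\<dots> \<le> 1 + 2 * y\<^sup>2"
  proof -
    have "y\<^sup>2 \<le> (1 / 2)\<^sup>2" using assms by (intro power_mono) auto
    then have "y\<^sup>2 * y\<^sup>2 \<le> 1 / 4 * y\<^sup>2" by (intro mult_right_mono) (auto simp: power2_eq_square)
    then have "16 / 9 * (y\<^sup>2 * y\<^sup>2) \<le> 4 / 9 * y\<^sup>2" by linarith
    moreover have "(4 / 3 * y\<^sup>2)\<^sup>2 = 16 / 9 * (y\<^sup>2 * y\<^sup>2)" by (simp add: power2_eq_square)
    ultimately show ?thesis using zero_le_power2[of y] by linarith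
  qed
  finally show ?thesis by (simp only: exp_add add_divide_distrib distrib_right times_divide_eq_left)
qed

text \<open>Completing the square shows positivity; it allows powers of this expression to be
  compared.\<close>

lemma one_plus_self_plus_square_third_nonneg: "0 \<le> 1 + z + z\<^sup>2 / (3 :: real)"
proof -
  have "1 + z + z\<^sup>2 / 3 = 1 / 4 + 3 * (1 / 2 + z / 3)\<^sup>2"
    by (simp add: power2_eq_square algebra_simps)
  also have "\<dots> \<ge> 0" by simp
  finally show ?thesis .
qed

text \<open>Averaging over the sign removes the first-order term, so T shared columns cost only the
  square of the accumulated correlation y = T x.\<close>

lemma tilt_power_average_le:
  assumes T: "T \<ge> (1 :: nat)" and y: "0 \<le> y" "y \<le> (1 / 2 :: real)" "real T * x = y"
  shows "((1 + x + x\<^sup>2 / 3) ^ T + (1 - x + x\<^sup>2 / 3) ^ T) / 2 \<le> 1 + 2 * y\<^sup>2"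
proof -
  \<comment> \<open>Since T is at least 1, T x^2 is at most (T x)^2, so the quadratic terms of the
    columns add up to no more than y^2.\<close>
  have "real T * x\<^sup>2 \<le> real T * (real T * x\<^sup>2)"
    using T by (intro mult_left_mono) (auto intro: mult_right_mono[of 1 "real T" "x\<^sup>2", simplified])
  also have "\<dots> = y\<^sup>2" using y(3) by (auto simp: power2_eq_square)
  finally have Tx: "real T * x\<^sup>2 \<le> y\<^sup>2" .
  have bound: "(1 + z + x\<^sup>2 / 3) ^ T \<le> exp (real T * z + y\<^sup>2 / 3)" if "\<bar>z\<bar> = \<bar>x\<bar>" for z
  proof -
    have "(1 + z + x\<^sup>2 / 3) ^ T \<le> exp (z + x\<^sup>2 / 3) ^ T"
    proof (rule power_mono)
      show "1 + z + x\<^sup>2 / 3 \<le> exp (z + x\<^sup>2 / 3)"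
        using exp_ge_add_one_self[of "z + x\<^sup>2 / 3"] by (simp add: add.assoc)
      have "x\<^sup>2 = z\<^sup>2" using that by (metis power2_abs)
      then show "0 \<le> 1 + z + x\<^sup>2 / 3" using one_plus_self_plus_square_third_nonneg[of z] by simp
    qed
    also have "\<dots> = exp (real T * z + real T * x\<^sup>2 / 3)"
      by (simp add: exp_of_nat_mult[symmetric] algebra_simps)
    also have "\<dots> \<le> exp (real T * z + y\<^sup>2 / 3)" using Tx by simp
    finally show ?thesis .
  qed
  have "(1 + x + x\<^sup>2 / 3) ^ T \<le> exp (y + y\<^sup>2 / 3)" "(1 - x + x\<^sup>2 / 3) ^ T \<le> exp (- y + y\<^sup>2 / 3)"
    using bound[of x] bound[of "- x"] y(3) by simp_all
  then show ?thesis using exp_average_le[OF y(1,2)] by simp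
qed

text \<open>\<open>A\<close> is chosen so that s/4 shifted rows already give the required energy.
  The p rows together contribute the exponent \<beta> = 32 \<rho>^4/p, a small multiple of log log n
  for \<rho>^2 of order sqrt(p log log n). The lower bound on \<open>s\<close> keeps A^2 at most
  1/2, as the sign average requires.\<close>

lemma minimax_risk_ge_half_dense:
  assumes "\<alpha> \<ge> 0" "K \<ge> 16" and n: "n \<ge> 2" and s: "100 \<le> s" "s \<le> p"
    and sp: "sqrt (real p * ln (ln (8 * real n))) \<le> real s"
    and \<rho>: "\<rho>\<^sup>2 \<le> sqrt (real p * ln (ln (8 * real n))) / 1000"
  shows "minimax_risk \<alpha> K p n s \<rho> \<ge> 1 / 2"
proof -
  define L where "L = ln (ln (8 * real n))"
  have L: "L \<ge> 1 / 2" unfolding L_def using n by (rule loglog_ge_half)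
  obtain m where m: "2 * 4 ^ (2 * m) \<le> n" "ln (8 * real n) \<le> 6 * real (m + 1)"
    using n by (rule ex_scale)
  have p: "p \<ge> 1" "real p > 0" "real s > 0" "real s \<le> real p" using s by auto
  define u where "u = real s / (4 * real p)"
  define A where "A = sqrt (8 * \<rho>\<^sup>2 / real s)"
  define \<beta> where "\<beta> = 32 * (\<rho>\<^sup>2)\<^sup>2 / real p"
  have A2: "A\<^sup>2 = 8 * \<rho>\<^sup>2 / real s" by (simp add: A_def)
  have u01: "0 \<le> u" "u + u \<le> 1" using p by (auto simp: u_def field_simps)
  note E3 = expectation_three[OF zero_less_one u01(1) u01(1) u01(2)]
  have "\<rho>\<^sup>2 \<le> real s / 1000" using sp \<rho> by simp
  then have A2': "A\<^sup>2 \<le> 1 / 2" using p by (simp add: A2 field_simps)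
  show ?thesis
  proof (rule minimax_risk_ge_half_grid[where A = A and \<beta> = \<beta> and m = m and lab = "\<lambda>_. three 1 u u"])
    have "(1::real) \<le> 4 ^ m" by (rule one_le_power) simp
    then show "A\<^sup>2 \<le> 4 ^ m" using A2' by linarith
    have "(\<rho>\<^sup>2)\<^sup>2 \<le> (sqrt (real p * L) / 1000)\<^sup>2"
      using \<rho> by (intro power_mono) (auto simp: L_def)
    also have "\<dots> = real p * L / 1000000" using L by (simp add: power_divide)
    finally have "\<beta> \<le> 32 * (real p * L / 1000000) / real p"
      unfolding \<beta>_def using p by (intro divide_right_mono mult_left_mono) auto
    also have "\<dots> \<le> 1 / 384 * L" using p L by simp
    finally have "\<beta> \<le> 1 / 384 * L" .
    then have "exp \<beta> \<le> exp (1 / 384 * L)" by simp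
    also have "\<dots> \<le> 1 + real (m + 1) / 64"
      unfolding L_def using n m by (intro exp_scaled_loglog_le) auto
    finally show "exp \<beta> \<le> 1 + real (m + 1) / 64" .
    show "set_pmf (three 1 u u) \<subseteq> {-1, 0, 1}"
      using set_pmf_three[OF zero_less_one u01(1) u01(1) u01(2)] by auto
    have "\<rho>\<^sup>2 \<le> A\<^sup>2 / 2 * l" if "real s / 4 \<le> l" for l
    proof -
      have "\<rho>\<^sup>2 = A\<^sup>2 / 2 * (real s / 4)" using p by (simp add: A2)
      also have "\<dots> \<le> A\<^sup>2 / 2 * l" using that by (intro mult_left_mono) auto
      finally show ?thesis .
    qed
    then show "3 / 4 \<le> measure (Pi_pmf {1..p} 0 (\<lambda>_. three 1 u u))
        {y. l0_norm p y \<le> s \<and> \<rho>\<^sup>2 \<le> A\<^sup>2 / 2 * real (l0_norm p y)}"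
      by (intro order.trans[OF prob_l0_norm_labels[OF p(1) s u_def]] measure_pmf.finite_measure_mono) auto
    fix T :: nat and r x :: real
    assume T: "T \<ge> 1" and r: "0 \<le> r" "r \<le> 1" and x: "real T * x = A\<^sup>2 * r"
    have Ar: "0 \<le> A\<^sup>2 * r" "A\<^sup>2 * r \<le> 1 / 2"
      using r A2' mult_mono[of "A\<^sup>2" "1 / 2" r 1] by auto
    let ?E = "measure_pmf.expectation (three 1 u u) (\<lambda>y. measure_pmf.expectation (three 1 u u) (\<lambda>z.
        (1 + y * z * x + (y * z * x)\<^sup>2 / 3) ^ T))"
    \<comment> \<open>Both labels are nonzero with probability 4 u^2, and their product is then 1 or
      -1 with equal probability; otherwise the factor is 1.\<close>
    have "?E = 1 + 4 * u\<^sup>2 * (((1 + x + x\<^sup>2 / 3) ^ T + (1 - x + x\<^sup>2 / 3) ^ T) / 2 - 1)"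
      by (simp add: E3) (simp add: algebra_simps power2_eq_square)
    also have "\<dots> \<le> 1 + 4 * u\<^sup>2 * (2 * (A\<^sup>2 * r)\<^sup>2)"
    proof (intro add_left_mono mult_left_mono)
      show "((1 + x + x\<^sup>2 / 3) ^ T + (1 - x + x\<^sup>2 / 3) ^ T) / 2 - 1 \<le> 2 * (A\<^sup>2 * r)\<^sup>2"
        using tilt_power_average_le[OF T Ar x] by linarith
    qed simp
    also have "\<dots> \<le> exp (4 * u\<^sup>2 * (2 * (A\<^sup>2 * r)\<^sup>2))"
      by (rule exp_ge_add_one_self)
    finally have "(\<Prod>i\<in>{1..p}. ?E) \<le> exp (4 * u\<^sup>2 * (2 * (A\<^sup>2 * r)\<^sup>2)) ^ p"
      by (subst prod_constant) (auto intro!: power_mono integral_nonneg_AE zero_le_power one_plus_self_plus_square_third_nonneg)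
    also have "\<dots> = exp (real p * (4 * u\<^sup>2 * (2 * (A\<^sup>2 * r)\<^sup>2)))"
      by (simp add: exp_of_nat_mult)
    also have "real p * (4 * u\<^sup>2 * (2 * (A\<^sup>2 * r)\<^sup>2)) = \<beta> * r\<^sup>2"
      using p by (simp add: u_def A2 \<beta>_def power_mult_distrib power_divide) (simp add: power2_eq_square field_simps)
    \<comment> \<open>The squared correlation is relaxed to a linear one, the form demanded by the
      grid bound.\<close>
    also have "\<dots> \<le> \<beta> * r"
      using r by (intro mult_left_mono) (auto simp: \<beta>_def power2_eq_square mult_left_le)
    finally show "(\<Prod>i\<in>{1..p}. ?E) \<le> exp (\<beta> * r)" by simp
  qed (use assms m p in \<open>auto simp: A_def \<beta>_def\<close>)
qed

section \<open>Spikes in the first column\<close>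

text \<open>The change point is 1, so only the first column differs between the hypotheses. The
  number \<open>r\<close> of rows that sets the label frequency may be smaller than
  \<open>s\<close>. A divergence of 1/(20p) per row gives exp(1/20) in total, below 17/16. The 8 in
  the condition on \<rho> combines (n - 1)/n at least 1/2 with at least r/4 shifted rows.\<close>

lemma minimax_risk_ge_half_first_column:
  assumes "\<alpha> \<ge> 0" "K \<ge> 16" and n: "n \<ge> 2" and s: "100 \<le> r" "r \<le> s" "s \<le> p"
    and w: "w = real r / (4 * real p)"
    and \<rho>: "\<rho>\<^sup>2 \<le> a\<^sup>2 * real r / 8"
    and null: "noise_pmf \<alpha> K 0 Q"
    and alt: "\<And>y. y \<in> {-1, 0, 1} \<Longrightarrow> noise_pmf \<alpha> K (y * a) (D y)"
    and supp: "\<And>y. y \<in> {-1, 0, 1} \<Longrightarrow> set_pmf (D y) \<subseteq> set_pmf Q"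
    and chi: "lr_inner Q (bind_pmf (three 1 w w) D) (bind_pmf (three 1 w w) D) \<le> 1 + 1 / (20 * real p)"
  shows "minimax_risk \<alpha> K p n s \<rho> \<ge> 1 / 2"
proof -
  have p: "p \<ge> 1" "real p > 0" "real r > 0" "real r \<le> real p" "r \<le> p" using s by auto
  have w01: "0 \<le> w" "w + w \<le> 1" using p by (auto simp: w field_simps)
  note fin3 = finite_set_pmf_three[OF zero_less_one w01(1) w01(1) w01(2)]
  have set3: "set_pmf (three 1 w w) \<subseteq> {-1, 0, 1}"
    using set_pmf_three[OF zero_less_one w01(1) w01(1) w01(2)] by auto
  define q where "q t = (if t \<le> 1 then Q else tilt 0)" for t :: nat
  define d where "d k y t = (if t \<le> 1 then D y else tilt 0)" for k t :: nat and y
  have tilt0: "noise_pmf \<alpha> K 0 (tilt 0)" using assms by (intro noise_pmf_tilt) auto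
  show ?thesis
  proof (rule minimax_risk_ge_half_of_prior[where G = "{1}" and lab = "\<lambda>_. three 1 w w"
        and a = "\<lambda>_. a" and q = q and d = d])
    show "noise_pmf \<alpha> K 0 (q t)" for t
      using null tilt0 by (simp add: q_def)
    show "noise_pmf \<alpha> K (if t \<le> k then y * a else 0) (d k y t)" if "k \<in> {1}" "y \<in> {-1, 0, 1}" for k y t
      using that alt[of y] tilt0 by (auto simp: d_def)
    show "set_pmf (d k y t) \<subseteq> set_pmf (q t)" if "y \<in> {-1, 0, 1}" for k y t
      using supp[OF that] by (simp add: d_def q_def)
    have "\<rho>\<^sup>2 \<le> real 1 * (real n - real 1) / real n * (a\<^sup>2 * l)" if "real r / 4 \<le> l" for l
    proof -
      have "\<rho>\<^sup>2 \<le> 1 / 2 * (a\<^sup>2 * (real r / 4))" using \<rho> by simp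
      also have "\<dots> \<le> real 1 * (real n - real 1) / real n * (a\<^sup>2 * l)"
        using that n p by (intro mult_mono) (auto simp: field_simps)
      finally show ?thesis .
    qed
    then show "3 / 4 \<le> measure (Pi_pmf {1..p} 0 (\<lambda>_. three 1 w w)) {y. l0_norm p y \<le> s \<and>
       (\<forall>k\<in>{1}. \<rho>\<^sup>2 \<le> real k * (real n - real k) / real n * (a\<^sup>2 * l0_norm p y))}"
      using s(2) by (intro order.trans[OF prob_l0_norm_labels[OF p(1) s(1) p(5) w]]
          measure_pmf.finite_measure_mono) auto
    have "(\<Prod>t\<in>{1..n}. lr_inner (q t) (d 1 y t) (d 1 z t)) = lr_inner Q (D y) (D z)" for y z
    proof -
      have "(\<Prod>t\<in>{1..n}. lr_inner (q t) (d 1 y t) (d 1 z t)) =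
          (\<Prod>t\<in>{1..n}. if t = 1 then lr_inner Q (D y) (D z) else 1)"
        using lr_inner_tilt[of 0 0] by (intro prod.cong refl) (simp add: q_def d_def)
      also have "\<dots> = lr_inner Q (D y) (D z)" using n by (simp add: prod.delta)
      finally show ?thesis .
    qed
    then have "(\<Prod>i\<in>{1..p}. measure_pmf.expectation (three 1 w w) (\<lambda>y. measure_pmf.expectation (three 1 w w) (\<lambda>z.
          \<Prod>t\<in>{1..n}. lr_inner (q t) (d 1 y t) (d 1 z t)))) =
        lr_inner Q (bind_pmf (three 1 w w) D) (bind_pmf (three 1 w w) D) ^ p"
      by (simp add: lr_inner_bind fin3)
    also have "\<dots> \<le> exp (1 / (20 * real p)) ^ p"
      using chi by (intro power_mono order.trans[OF chi exp_ge_add_one_self] lr_inner_nonneg)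
    also have "\<dots> = exp (1 / 20)"
      using p by (simp add: exp_of_nat_mult[symmetric])
    also have "\<dots> \<le> 1 + 1 / 20 + (1 / 20)\<^sup>2" by (rule exp_bound) auto
    also have "\<dots> \<le> 17 / 16" by (simp add: power2_eq_square)
    finally show "(\<Sum>k\<in>{1}. \<Sum>l\<in>{1}. \<Prod>i\<in>{1..p}.
        measure_pmf.expectation (three 1 w w) (\<lambda>y. measure_pmf.expectation (three 1 w w) (\<lambda>z.
          \<Prod>t\<in>{1..n}. lr_inner (q t) (d k y t) (d l z t)))) \<le> 17 / 16 * (real (card {1 :: nat}))\<^sup>2"
      by simp
  qed (use n p set3 in auto)
qed

section \<open>Null noise with spikes\<close>

definition bump :: "real \<Rightarrow> real pmf" where
  "bump v = three 2 (v / 8) (v / 8)"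

definition spike :: "real \<Rightarrow> real \<Rightarrow> real pmf" where
  "spike a y = map_pmf (\<lambda>x. x + y * a) (tilt 0)"

lemma set_pmf_spike: "set_pmf (spike a y) = {y * a + 2, y * a - 2, y * a}"
  by (auto simp: spike_def set_pmf_tilt_0)

lemma expectation_spike:
  "measure_pmf.expectation (spike a y) f = (f (y * a + 2) + f (y * a - 2) + 6 * f (y * a)) / (8 :: real)"
  unfolding spike_def integral_map_pmf by (subst expectation_tilt) (auto simp: add.commute field_simps)

lemma noise_pmf_spike:
  assumes "\<alpha> \<ge> 0" "K \<ge> 16"
  shows "noise_pmf \<alpha> K (y * a) (spike a y)"
  by (rule noise_pmf_of_bounded)
    (use assms in \<open>auto simp: expectation_spike set_pmf_spike\<close>)

context
  fixes a u v :: real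
  assumes u: "0 < u" "2 * u < 1" and v: "0 < v" "v \<le> 1"
begin

text \<open>A spike occurs with probability 2u. The remaining part, \<open>bump v\<close>, has
  variance v, and \<open>bump 1\<close> coincides with \<open>tilt 0\<close>. Taking v below 1 makes
  room for the variance of the spikes.\<close>

definition spiky :: "real pmf" where
  "spiky = bind_pmf (three 1 u u) (\<lambda>y. if y = 0 then bump v else spike a y)"

lemma u3: "(0::real) < 1" "0 \<le> u" "0 \<le> u" "u + u \<le> 1"
  using u by auto

lemma v3: "(0::real) < 2" "0 \<le> v / 8" "0 \<le> v / 8" "v / 8 + v / 8 \<le> 1"
  using v by auto

lemmas expectation_bump = expectation_three[OF v3, folded bump_def]
lemmas pmf_bump = pmf_three[OF v3, folded bump_def]

lemma set_pmf_bump: "set_pmf (bump v) = {2, - 2, 0}"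
  using v unfolding set_pmf_eq pmf_bump by (auto split: if_splits)

lemma set_pmf_three_u: "set_pmf (three 1 u u) = {1, - 1, 0}"
  using u unfolding set_pmf_eq pmf_three[OF u3] by (auto split: if_splits)

lemma pmf_spiky: "pmf spiky x = (1 - 2 * u) * pmf (bump v) x + u * (pmf (spike a 1) x + pmf (spike a (- 1)) x)"
  unfolding spiky_def pmf_bind by (simp add: expectation_three[OF u3] algebra_simps)

lemma set_pmf_spiky: "set_pmf spiky = {2, - 2, 0} \<union> set_pmf (spike a 1) \<union> set_pmf (spike a (- 1))"
  unfolding spiky_def by (auto simp: set_pmf_three_u set_pmf_bump)

lemma finite_set_pmf_spiky: "finite (set_pmf spiky)"
  by (simp add: set_pmf_spiky set_pmf_spike)

lemma expectation_spiky:
  "measure_pmf.expectation spiky f = (1 - 2 * u) * measure_pmf.expectation (bump v) f +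
    u * (measure_pmf.expectation (spike a 1) f + measure_pmf.expectation (spike a (- 1)) (f :: real \<Rightarrow> real))"
proof -
  have "measure_pmf.expectation spiky f = (\<Sum>y\<in>{1, - 1, 0}. pmf (three 1 u u) y *\<^sub>R
      measure_pmf.expectation (if y = 0 then bump v else spike a y) f)"
    unfolding spiky_def
    by (rule pmf_expectation_bind) (auto simp: set_pmf_three_u set_pmf_bump set_pmf_spike)
  then show ?thesis by (simp add: pmf_three[OF u3] algebra_simps)
qed

text \<open>Since K is at least 16 and \<alpha> at least 2, atoms of size at most 4 contribute at
  most 1/16 to the moment. For a above 2 the spikes satisfy |x/K| at most a/8, which gives
  a^\<alpha>/64 and leaves ample room below 1.\<close>

lemma noise_pmf_spiky:
  assumes var: "(1 - 2 * u) * v + 2 * u * (1 + a\<^sup>2) = 1"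
    and \<alpha>: "\<alpha> \<ge> 2" and K: "K \<ge> 16" and a: "0 \<le> a" and mom: "2 * u * a powr \<alpha> \<le> 1"
  shows "noise_pmf \<alpha> K 0 spiky"
  unfolding noise_pmf_def
proof (intro conjI)
  show "measure_pmf.expectation spiky (\<lambda>x. x) = 0"
    by (simp add: expectation_spiky expectation_bump expectation_spike)
  have "measure_pmf.expectation spiky (\<lambda>x. (x - 0)\<^sup>2) = (1 - 2 * u) * v + 2 * u * (1 + a\<^sup>2)"
    by (simp add: expectation_spiky expectation_bump expectation_spike)
      (simp add: power2_eq_square algebra_simps add_divide_distrib diff_divide_distrib)
  then show "measure_pmf.expectation spiky (\<lambda>x. (x - 0)\<^sup>2) = 1" using var by simp
  define b where "b x = \<bar>x / K\<bar> powr \<alpha>" for x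
  define B where "B = 1 / 16 + a powr \<alpha> / 64"
  have small: "b x \<le> 1 / 16" if "\<bar>x\<bar> \<le> 4" for x
  proof -
    have "\<bar>x / K\<bar> \<le> 1 / 4" using that K by (simp add: abs_divide divide_le_eq)
    then have "b x \<le> (1 / 4) powr \<alpha>" unfolding b_def using \<alpha> by (intro powr_mono2) auto
    also have "\<dots> \<le> (1 / 4) powr 2" using \<alpha> by (intro powr_mono') auto
    finally show ?thesis by (simp add: power2_eq_square)
  qed
  have large: "b x \<le> B" if x: "\<bar>x\<bar> \<le> a + 2" for x
  proof (cases "a \<le> 2")
    case True
    then have "b x \<le> 1 / 16" using x by (intro small) simp
    then show ?thesis by (simp add: B_def add_increasing2)
  next
    case False
    have "\<bar>x / K\<bar> \<le> (2 * a) / 16" unfolding abs_divide using False x K by (intro frac_le) auto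
    then have "b x \<le> (a / 8) powr \<alpha>" unfolding b_def using \<alpha> by (intro powr_mono2) auto
    also have "\<dots> = a powr \<alpha> * (1 / 8) powr \<alpha>"
      using a by (subst powr_mult[symmetric]) auto
    also have "\<dots> \<le> a powr \<alpha> * (1 / 8) powr 2" using \<alpha> by (intro mult_left_mono powr_mono') auto
    finally show ?thesis by (simp add: B_def power2_eq_square)
  qed
  have "measure_pmf.expectation (bump v) b \<le> 1 / 16"
  proof -
    have "measure_pmf.expectation (bump v) b \<le> v / 8 * (1 / 16) + v / 8 * (1 / 16) + (1 - v / 8 - v / 8) * (1 / 16)"
      unfolding expectation_bump using v by (intro add_mono mult_left_mono small) auto
    also have "\<dots> = 1 / 16" by (simp add: field_simps)
    finally show ?thesis .
  qed
  moreover have "measure_pmf.expectation (spike a y) b \<le> B" if "y \<in> {1, - 1}" for y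
  proof -
    have "measure_pmf.expectation (spike a y) b \<le> (B + B + 6 * B) / 8"
      unfolding expectation_spike using that a by (intro divide_right_mono add_mono mult_left_mono large) auto
    then show ?thesis by simp
  qed
  ultimately have "measure_pmf.expectation spiky b \<le> (1 - 2 * u) * (1 / 16) + u * (B + B)"
    unfolding expectation_spiky using u by (intro add_mono mult_left_mono) auto
  also have "\<dots> = 1 / 16 + 2 * u * a powr \<alpha> / 64" by (simp add: B_def field_simps)
  also have "\<dots> \<le> 1" using mom by linarith
  finally have "measure_pmf.expectation spiky b \<le> 1" .
  moreover have "(\<lambda>x. \<bar>(x - 0) / K\<bar> powr \<alpha>) = b" by (simp add: b_def fun_eq_iff)
  ultimately show "measure_pmf.expectation spiky (\<lambda>x. \<bar>(x - 0) / K\<bar> powr \<alpha>) \<le> 1"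
    by (simp only:)
qed (rule finite_set_pmf_spiky)

text \<open>Both laws contain the same spikes, so they differ only in the bulk,
  \<open>tilt 0\<close> against \<open>bump v\<close>, hence only at three atoms and by order 1 - v.
  Dropping the spikes from the denominator only increases the bound; v at least 1/2 keeps the bulk
  weights bounded below.\<close>

lemma lr_inner_spiky_spikes_le:
  assumes "1 / 2 \<le> v"
  defines "M \<equiv> bind_pmf (three 1 u u) (spike a)"
  shows "lr_inner spiky M M \<le> 1 + (1 - v)\<^sup>2"
proof -
  have sub: "set_pmf M \<subseteq> set_pmf spiky"
    unfolding M_def set_pmf_spiky by (auto simp: set_pmf_three_u set_pmf_spike)
  have pM: "pmf M x = (1 - 2 * u) * pmf (tilt 0) x + u * (pmf (spike a 1) x + pmf (spike a (- 1)) x)" for x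
    unfolding M_def pmf_bind by (simp add: expectation_three[OF u3] spike_def algebra_simps)
  have "(\<Sum>x\<in>set_pmf spiky. (pmf M x - pmf spiky x)\<^sup>2 / pmf spiky x) =
      (\<Sum>x\<in>{2, - 2, 0}. (pmf M x - pmf spiky x)\<^sup>2 / pmf spiky x)"
    using set_pmf_spiky finite_set_pmf_spiky
    by (intro sum.mono_neutral_right) (auto simp: pM pmf_spiky pmf_bump pmf_tilt)
  also have "\<dots> \<le> (\<Sum>x\<in>{2, - 2, 0}. (pmf (tilt 0) x - pmf (bump v) x)\<^sup>2 / pmf (bump v) x)"
  proof (rule sum_mono)
    fix x :: real assume "x \<in> {2, - 2, 0}"
    then have g: "0 < pmf (bump v) x" using set_pmf_bump by (intro pmf_positive) auto
    have "(pmf M x - pmf spiky x)\<^sup>2 = (1 - 2 * u)\<^sup>2 * (pmf (tilt 0) x - pmf (bump v) x)\<^sup>2"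
      unfolding pM pmf_spiky power_mult_distrib[symmetric] by (simp add: algebra_simps)
    moreover have "(1 - 2 * u) * pmf (bump v) x \<le> pmf spiky x"
      using u by (simp add: pmf_spiky)
    ultimately have "(pmf M x - pmf spiky x)\<^sup>2 / pmf spiky x \<le>
        (1 - 2 * u)\<^sup>2 * (pmf (tilt 0) x - pmf (bump v) x)\<^sup>2 / ((1 - 2 * u) * pmf (bump v) x)"
      using u g by (simp add: frac_le)
    also have "\<dots> = (1 - 2 * u) * ((pmf (tilt 0) x - pmf (bump v) x)\<^sup>2 / pmf (bump v) x)"
      using u g by (simp add: power2_eq_square field_simps)
    also have "\<dots> \<le> 1 * ((pmf (tilt 0) x - pmf (bump v) x)\<^sup>2 / pmf (bump v) x)"
      using u g by (intro mult_right_mono) auto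
    finally show "(pmf M x - pmf spiky x)\<^sup>2 / pmf spiky x \<le>
        (pmf (tilt 0) x - pmf (bump v) x)\<^sup>2 / pmf (bump v) x" by simp
  qed
  also have "\<dots> = 2 * ((1 / 8 - v / 8)\<^sup>2 / (v / 8)) + (3 / 4 - (1 - v / 8 - v / 8))\<^sup>2 / (1 - v / 8 - v / 8)"
    by (simp add: pmf_bump pmf_tilt)
  also have "\<dots> \<le> 2 * ((1 / 8 - v / 8)\<^sup>2 / (1 / 16)) + (3 / 4 - (1 - v / 8 - v / 8))\<^sup>2 / (3 / 4)"
    using assms v by (intro add_mono mult_left_mono divide_left_mono) auto
  also have "\<dots> = (1 - v)\<^sup>2 * (7 / 12)"
    by (simp add: power2_eq_square algebra_simps add_divide_distrib diff_divide_distrib)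
  also have "\<dots> \<le> (1 - v)\<^sup>2" by simp
  finally show ?thesis
    by (subst lr_inner_eq_chi_square[OF finite_set_pmf_spiky sub]) simp
qed

text \<open>Here \<open>spiky\<close> is contaminated by additional spikes. It already contains u
  times the spike density \<open>R\<close>, so \<open>R\<close> relative to \<open>spiky\<close> is
  at most 1/u, and \<open>R\<close> has total mass 2.\<close>

lemma lr_inner_spiky_contamination_le:
  assumes w: "0 \<le> w" "2 * w \<le> 1"
  defines "M \<equiv> bind_pmf (three 1 w w) (\<lambda>y. if y = 0 then spiky else spike a y)"
  shows "lr_inner spiky M M \<le> 1 + 2 * w\<^sup>2 / u"
proof -
  have w3: "(0::real) < 1" "0 \<le> w" "0 \<le> w" "w + w \<le> 1" using w by auto
  have sub: "set_pmf M \<subseteq> set_pmf spiky"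
    using set_pmf_three[OF w3] unfolding M_def by (fastforce simp: set_pmf_spiky)
  define R where "R x = pmf (spike a 1) x + pmf (spike a (- 1)) x" for x
  have pM: "pmf M x - pmf spiky x = w * (R x - 2 * pmf spiky x)" for x
    unfolding M_def pmf_bind by (simp add: expectation_three[OF w3] R_def algebra_simps)
  have R: "0 \<le> R x" "u * R x \<le> pmf spiky x" for x
    using u by (simp_all add: R_def pmf_spiky)
  have "(\<Sum>x\<in>set_pmf spiky. (pmf M x - pmf spiky x)\<^sup>2 / pmf spiky x) \<le>
      (\<Sum>x\<in>set_pmf spiky. w\<^sup>2 * (R x / u - 4 * R x + 4 * pmf spiky x))"
  proof (rule sum_mono)
    fix x assume "x \<in> set_pmf spiky"
    then have q: "0 < pmf spiky x" by (rule pmf_positive)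
    have "(pmf M x - pmf spiky x)\<^sup>2 / pmf spiky x =
        w\<^sup>2 * (R x * R x / pmf spiky x - 4 * R x + 4 * pmf spiky x)"
      using q unfolding pM by (simp add: power2_eq_square field_simps)
    also have "R x * R x / pmf spiky x \<le> R x / u"
      using mult_left_mono[OF R(2)[of x] R(1)[of x]] u q by (simp add: field_simps)
    finally show "(pmf M x - pmf spiky x)\<^sup>2 / pmf spiky x \<le> w\<^sup>2 * (R x / u - 4 * R x + 4 * pmf spiky x)"
      by (simp add: mult_left_mono)
  qed
  also have "\<dots> = w\<^sup>2 * ((\<Sum>x\<in>set_pmf spiky. R x) / u - 4 * (\<Sum>x\<in>set_pmf spiky. R x) +
      4 * (\<Sum>x\<in>set_pmf spiky. pmf spiky x))"
    by (simp add: sum_distrib_left[symmetric] sum_divide_distrib[symmetric] sum.distrib sum_subtractf)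
  also have "(\<Sum>x\<in>set_pmf spiky. R x) = 2"
  proof -
    have "(\<Sum>x\<in>set_pmf spiky. pmf (spike a y) x) = 1" if "y \<in> {1, - 1}" for y
      using that by (intro sum_pmf_eq_1 finite_set_pmf_spiky) (auto simp: set_pmf_spiky)
    then show ?thesis by (simp add: R_def sum.distrib)
  qed
  also have "(\<Sum>x\<in>set_pmf spiky. pmf spiky x) = 1"
    using finite_set_pmf_spiky by (simp add: sum_pmf_eq_1)
  also have "w\<^sup>2 * (2 / u - 4 * 2 + 4 * 1) \<le> w\<^sup>2 * (2 / u)"
    by (intro mult_left_mono) auto
  finally show ?thesis
    by (subst lr_inner_eq_chi_square[OF finite_set_pmf_spiky sub]) (simp add: mult.commute)
qed

end

text \<open>The spikes of the null noise have exactly the frequency and height of the shifts in the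
  alternatives, whose own noise is \<open>tilt 0\<close>. Only the variance deficit 1 - v of the
  null bulk could betray the difference. The first bound on \<rho> serves the moment condition, the
  second the divergence.\<close>

lemma minimax_risk_ge_half_sparse:
  assumes \<alpha>: "\<alpha> \<ge> 2" and K: "K \<ge> 16" and n: "n \<ge> 2" and s: "100 \<le> s" "s \<le> p"
    and \<rho>: "\<rho>\<^sup>2 \<le> real s * (real p / real s) powr (2 / \<alpha>) / 1000" "\<rho>\<^sup>2 \<le> sqrt (real p) / 1000"
  shows "minimax_risk \<alpha> K p n s \<rho> \<ge> 1 / 2"
proof -
  have p: "real p > 0" "real s > 0" "real s \<le> real p" using s by auto
  define a where "a = sqrt (8 * \<rho>\<^sup>2 / real s)"
  define u where "u = real s / (4 * real p)"
  \<comment> \<open>Solves the variance equation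
    \<open>(1 - 2 * u) * v + 2 * u * (1 + a\<^sup>2) = 1\<close>.\<close>
  define v where "v = 1 - 2 * u * a\<^sup>2 / (1 - 2 * u)"
  have a2: "a\<^sup>2 = 8 * \<rho>\<^sup>2 / real s" "0 \<le> a" by (simp_all add: a_def)
  have u: "0 < u" "2 * u \<le> 1 / 2" "2 * u < 1" using p by (auto simp: u_def field_simps)
  have v1: "0 \<le> 1 - v" "1 - v \<le> 8 * \<rho>\<^sup>2 / real p"
  proof -
    show "0 \<le> 1 - v" using u by (simp add: v_def)
    have "1 - v = 2 * u * a\<^sup>2 / (1 - 2 * u)" by (simp add: v_def)
    also have "\<dots> \<le> 2 * u * a\<^sup>2 / (1 / 2)"
      using u by (intro divide_left_mono) auto
    also have "\<dots> = 8 * \<rho>\<^sup>2 / real p" using p by (simp add: a2 u_def)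
    finally show "1 - v \<le> 8 * \<rho>\<^sup>2 / real p" .
  qed
  \<comment> \<open>The bound of \<rho>^2 by sqrt p enters here: the deficit is of order 1/sqrt p,
    so its square is of order 1/p per row.\<close>
  have v2: "(1 - v)\<^sup>2 \<le> 1 / (20 * real p)"
  proof -
    have "1 - v \<le> 8 * (sqrt (real p) / 1000) / real p"
      using p \<rho>(2) by (intro order.trans[OF v1(2)] divide_right_mono mult_left_mono) auto
    then have "(1 - v)\<^sup>2 \<le> (8 * (sqrt (real p) / 1000) / real p)\<^sup>2"
      using v1(1) by (rule power_mono)
    also have "\<dots> = 64 / 1000000 / real p"
      using p by (simp add: power_mult_distrib power_divide) (simp add: power2_eq_square)
    also have "\<dots> \<le> 1 / (20 * real p)" using p by (simp add: field_simps)
    finally show ?thesis .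
  qed
  have v3: "1 / 2 \<le> v"
  proof -
    have "1 / (20 * real p) \<le> 1 / 4" using s by (intro divide_left_mono) auto
    then have "(1 - v)\<^sup>2 \<le> (1 / 2)\<^sup>2" using v2 by (simp add: power2_eq_square)
    then have "1 - v \<le> 1 / 2" by (rule power2_le_imp_le) simp
    then show ?thesis by simp
  qed
  have v4: "0 < v" "v \<le> 1" using v1 v3 by auto
  have mom: "2 * u * a powr \<alpha> \<le> 1"
  proof -
    have "a\<^sup>2 \<le> (real p / real s) powr (2 / \<alpha>)"
    proof -
      have "\<rho>\<^sup>2 / real s \<le> (real p / real s) powr (2 / \<alpha>) / 1000"
        using \<rho>(1) p by (simp add: field_simps)
      moreover have "0 \<le> (real p / real s) powr (2 / \<alpha>)" by simp
      moreover have "a\<^sup>2 = 8 * (\<rho>\<^sup>2 / real s)" by (simp add: a2)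
      ultimately show ?thesis by linarith
    qed
    then have "(a\<^sup>2) powr (\<alpha> / 2) \<le> ((real p / real s) powr (2 / \<alpha>)) powr (\<alpha> / 2)"
      using \<alpha> by (intro powr_mono2) auto
    also have "\<dots> = real p / real s" using p \<alpha> by (simp add: powr_powr)
    also have "(a\<^sup>2) powr (\<alpha> / 2) = a powr \<alpha>"
    proof -
      have "a\<^sup>2 = a powr 2" using a2(2) by simp
      then show ?thesis by (simp only: powr_powr) simp
    qed
    finally have "a powr \<alpha> \<le> real p / real s" .
    then have "2 * u * a powr \<alpha> \<le> 2 * u * (real p / real s)"
      using u by (intro mult_left_mono) auto
    also have "\<dots> \<le> 1" using p by (simp add: u_def)
    finally show ?thesis .
  qed
  have var: "(1 - 2 * u) * v + 2 * u * (1 + a\<^sup>2) = 1"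
    using u by (simp add: v_def field_simps)
  show ?thesis
  proof (rule minimax_risk_ge_half_first_column[where r = s and w = u and a = a and
        Q = "spiky a u v" and D = "spike a"])
    show "noise_pmf \<alpha> K 0 (spiky a u v)"
      using u v4 var \<alpha> K a2(2) mom by (intro noise_pmf_spiky)
    show "set_pmf (spike a y) \<subseteq> set_pmf (spiky a u v)" if "y \<in> {- 1, 0, 1}" for y
      using that u v4 by (auto simp: set_pmf_spiky set_pmf_spike)
    show "lr_inner (spiky a u v) (three 1 u u \<bind> spike a) (three 1 u u \<bind> spike a) \<le> 1 + 1 / (20 * real p)"
      using lr_inner_spiky_spikes_le[OF u(1,3) v4 v3, of a] v2 by simp
  qed (use assms p in \<open>auto simp: u_def a2 intro: noise_pmf_spike\<close>)
qed

text \<open>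
  For \<open>\<alpha> < 4\<close> even a bounded number of spikes of height about \<open>p powr (1 / \<alpha>)\<close> goes unnoticed,
  since under the null many more spikes may occur already.
\<close>

lemma minimax_risk_ge_half_heavy:
  assumes \<alpha>: "\<alpha> \<ge> 2" and K: "K \<ge> 16" and n: "n \<ge> 2" and s: "100 \<le> s" "s \<le> p"
    and p: "p \<ge> 200000" and \<rho>: "\<rho>\<^sup>2 \<le> real p powr (2 / \<alpha>) / 16000"
  shows "minimax_risk \<alpha> K p n s \<rho> \<ge> 1 / 2"
proof -
  \<comment> \<open>The constants fit together as follows: w = 25/p belongs to r = 100 in the label
    frequency, u is 1000 times larger so that 2 w^2/u = 1/(20p), and then a^\<alpha> = p/200000
    makes 2 u a^\<alpha> equal to 1/4. Since a is at least 1, also 2 u a^2 is at most 1/4, which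
    keeps v positive.\<close>
  define a where "a = (real p / 200000) powr (1 / \<alpha>)"
  define u where "u = 25000 / real p"
  define w where "w = real (100 :: nat) / (4 * real p)"
  define v where "v = 1 - 2 * u * a\<^sup>2 / (1 - 2 * u)"
  have p': "real p \<ge> 200000" using p by simp
  have a1: "1 \<le> a" unfolding a_def using p' \<alpha> by (intro ge_one_powr_ge_zero) auto
  have u: "0 < u" "2 * u \<le> 1 / 4" "2 * u < 1" using p' by (auto simp: u_def field_simps)
  have w: "0 \<le> w" "2 * w \<le> 1" using p' by (auto simp: w_def field_simps)
  have a\<alpha>: "a powr \<alpha> = real p / 200000" using \<alpha> p' by (simp add: a_def powr_powr)
  have a2: "a\<^sup>2 = (real p / 200000) powr (2 / \<alpha>)"
  proof -
    have "a\<^sup>2 = a powr 2" using a1 by simp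
    then show ?thesis by (simp only: a_def powr_powr) simp
  qed
  have "a\<^sup>2 = a powr 2" using a1 by simp
  also have "\<dots> \<le> a powr \<alpha>" using a1 \<alpha> by (intro powr_mono) auto
  finally have "2 * u * a\<^sup>2 \<le> 2 * u * (real p / 200000)"
    unfolding a\<alpha> using u by (intro mult_left_mono) auto
  also have "\<dots> = 1 / 4" using p' by (simp add: u_def)
  finally have ua: "2 * u * a\<^sup>2 \<le> 1 / 4" .
  have v: "0 < v" "v \<le> 1"
  proof -
    have "2 * u * a\<^sup>2 / (1 - 2 * u) < 1" using ua u by (simp add: divide_less_eq)
    then show "0 < v" by (simp add: v_def)
    show "v \<le> 1" using u by (simp add: v_def)
  qed
  have var: "(1 - 2 * u) * v + 2 * u * (1 + a\<^sup>2) = 1"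
    using u by (simp add: v_def field_simps)
  have mom: "2 * u * a powr \<alpha> \<le> 1" using p' by (simp add: a\<alpha> u_def)
  \<comment> \<open>Unshifted entries keep the spiky law of the null; a shift replaces it by a pure
    spike.\<close>
  let ?D = "\<lambda>y. if y = 0 then spiky a u v else spike a y"
  show ?thesis
  proof (rule minimax_risk_ge_half_first_column[where r = 100 and w = w and a = a and
        Q = "spiky a u v" and D = ?D])
    show null: "noise_pmf \<alpha> K 0 (spiky a u v)"
      using u v var \<alpha> K a1 mom by (intro noise_pmf_spiky) auto
    show "noise_pmf \<alpha> K (y * a) (?D y)" for y
      using null noise_pmf_spike[of \<alpha> K y a] \<alpha> K by simp
    show "set_pmf (?D y) \<subseteq> set_pmf (spiky a u v)" if "y \<in> {- 1, 0, 1}" for y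
      using that u v by (auto simp: set_pmf_spiky)
    have "lr_inner (spiky a u v) (three 1 w w \<bind> ?D) (three 1 w w \<bind> ?D) \<le> 1 + 2 * w\<^sup>2 / u"
      using u v w by (intro lr_inner_spiky_contamination_le) auto
    also have "2 * w\<^sup>2 / u = 1 / (20 * real p)"
      using p' by (simp add: w_def u_def power2_eq_square)
    finally show "lr_inner (spiky a u v) (three 1 w w \<bind> ?D) (three 1 w w \<bind> ?D) \<le> 1 + 1 / (20 * real p)" .
    \<comment> \<open>As 2/\<alpha> is at most 1, the constant 200000 can leave the power;
      200000/16000 = 100/8 then matches the energy condition.\<close>
    have "real p powr (2 / \<alpha>) / 200000 \<le> real p powr (2 / \<alpha>) / 200000 powr (2 / \<alpha>)"
      using \<alpha> powr_mono[of "2 / \<alpha>" 1 200000] by (intro divide_left_mono) auto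
    also have "\<dots> = a\<^sup>2" unfolding a2 by (rule powr_divide[symmetric])
    finally show "\<rho>\<^sup>2 \<le> a\<^sup>2 * real 100 / 8" using \<rho> by simp
  qed (use assms in \<open>auto simp: w_def\<close>)
qed

section \<open>Combination of the four bounds\<close>

theorem theorem6:
  "\<exists>c\<ge>1::real. \<forall>\<alpha>\<ge>2::real. \<exists>K\<^sub>\<alpha>>0::real. \<forall>K\<ge>K\<^sub>\<alpha>. \<exists>c'>0::real.
     \<forall>n\<ge>2::nat. \<forall>p\<ge>1::nat. \<forall>s\<in>{1..p}. real s \<ge> c \<longrightarrow>
       (\<forall>\<rho>::real. \<rho>\<^sup>2 \<le> c' * v_lower \<alpha> p n s \<longrightarrow> minimax_risk \<alpha> K p n s \<rho> \<ge> 1 / 2)"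
proof -
  have main: "minimax_risk \<alpha> K p n s \<rho> \<ge> 1 / 2"
    if \<alpha>: "\<alpha> \<ge> 2" and K: "K \<ge> 16" and n: "n \<ge> 2" and s: "s \<in> {1..p}" "real s \<ge> 100"
      and \<rho>: "\<rho>\<^sup>2 \<le> 1 / 10 ^ 10 * v_lower \<alpha> p n s"
    for \<alpha> K :: real and n p s :: nat and \<rho> :: real
  proof -
    define L where "L = ln (ln (8 * real n))"
    define A1 where "A1 = real s * (real p / real s) powr (2 / \<alpha>)"
    define A2 where "A2 = real p powr max (2 / \<alpha>) (1 / 2) * L powr omega2 \<alpha> p n s"
    have L: "1 / 2 \<le> L" unfolding L_def using n by (rule loglog_ge_half)
    have s': "100 \<le> s" "s \<le> p" "1 \<le> p" using s by auto
    have p: "real p \<ge> 100" using s' by simp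
    have v: "v_lower \<alpha> p n s = min A1 A2 + L"
      by (simp add: v_lower_def A1_def A2_def L_def)
    show ?thesis
    proof (cases "\<rho>\<^sup>2 \<le> L / 1000")
      case True
      then show ?thesis
        unfolding L_def using \<alpha> K s' n by (intro minimax_risk_ge_half_one_coordinate) auto
    next
      case False
      \<comment> \<open>Now L is below 1000 \<rho>^2, so the minimum must account for almost all of
        10^10 \<rho>^2.\<close>
      have A: "\<rho>\<^sup>2 \<le> min A1 A2 / 10 ^ 9"
      proof -
        have "L \<le> 1000 * \<rho>\<^sup>2" using False by simp
        moreover have "10000000000 * \<rho>\<^sup>2 \<le> min A1 A2 + L" using \<rho> unfolding v by simp
        ultimately have "1000000000 * \<rho>\<^sup>2 \<le> min A1 A2" using zero_le_power2[of \<rho>] by linarith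
        then show ?thesis by simp
      qed
      have scale: "\<rho>\<^sup>2 \<le> X / 1000" "\<rho>\<^sup>2 \<le> X / 16000" if "\<rho>\<^sup>2 \<le> X / 10 ^ 9" for X
      proof -
        have "1000000000 * \<rho>\<^sup>2 \<le> X" using that by simp
        then show "\<rho>\<^sup>2 \<le> X / 1000" "\<rho>\<^sup>2 \<le> X / 16000" using zero_le_power2[of \<rho>] by linarith+
      qed
      have A12: "\<rho>\<^sup>2 \<le> A1 / 10 ^ 9" "\<rho>\<^sup>2 \<le> A2 / 10 ^ 9" using A by auto
      show ?thesis
      proof (cases "\<alpha> \<ge> 4")
        case False
        then have "2 / \<alpha> \<ge> 1 / 2" using \<alpha> by (simp add: field_simps)
        then have "max (2 / \<alpha>) (1 / 2) = 2 / \<alpha>" by simp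
        then have A2: "A2 = real p powr (2 / \<alpha>)"
          using False L by (simp add: A2_def omega2_def)
        \<comment> \<open>For smaller p the bound by \<open>A2\<close> would give \<rho>^2 at most
          2/10^4, whereas \<rho>^2 exceeds L/1000, hence 5/10^4.\<close>
        have "p \<ge> 200000"
        proof (rule ccontr)
          assume "\<not> p \<ge> 200000"
          have "A2 \<le> real p powr 1" unfolding A2 using p \<alpha> by (intro powr_mono) auto
          then have "A2 \<le> 200000" using p \<open>\<not> p \<ge> 200000\<close> by simp
          then have "\<rho>\<^sup>2 \<le> 200000 / 10 ^ 9" using A12(2) by simp
          then show False using L \<open>\<not> \<rho>\<^sup>2 \<le> L / 1000\<close> by simp
        qed
        then show ?thesis
          using scale[OF A12(2)] A2 \<alpha> K n s' by (intro minimax_risk_ge_half_heavy) auto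
      next
        case True
        then have "2 / \<alpha> \<le> 1 / 2" by (simp add: field_simps)
        then have max: "real p powr max (2 / \<alpha>) (1 / 2) = sqrt (real p)"
          by (simp add: powr_half_sqrt)
        show ?thesis
        \<comment> \<open>This threshold is where \<open>omega2\<close> switches: below it the
          spikes give sqrt p, above it the random signs over the grid give the additional factor
          sqrt L.\<close>
        proof (cases "real s > sqrt (real p * L)")
          case False
          then have "A2 = sqrt (real p)"
            using L max by (simp add: A2_def omega2_def L_def[symmetric])
          then show ?thesis
            using scale[OF A12(1)] scale[OF A12(2)] \<alpha> K n s' by (intro minimax_risk_ge_half_sparse) (auto simp: A1_def)
        next
          case big: True
          then have "A2 = sqrt (real p * L)"
            using L max True by (simp add: A2_def omega2_def L_def[symmetric] powr_half_sqrt real_sqrt_mult)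
          then show ?thesis
            using scale[OF A12(2)] big \<alpha> K n s' by (intro minimax_risk_ge_half_dense) (auto simp: L_def)
        qed
      qed
    qed
  qed
  show ?thesis
  \<comment> \<open>The value 100 comes from the concentration of the number of shifted rows, and 16
    from the moment bounds. The constants chosen for \<open>K\<^sub>\<alpha>\<close> and
    \<open>c'\<close> are the same for all \<alpha> and K.\<close>
  proof (rule exI[of _ 100], intro conjI allI impI)
    fix \<alpha> :: real assume "2 \<le> \<alpha>"
    then show "\<exists>K\<^sub>\<alpha>>0::real. \<forall>K\<ge>K\<^sub>\<alpha>. \<exists>c'>0::real.
     \<forall>n\<ge>2::nat. \<forall>p\<ge>1::nat. \<forall>s\<in>{1..p}. real s \<ge> 100 \<longrightarrow>
       (\<forall>\<rho>::real. \<rho>\<^sup>2 \<le> c' * v_lower \<alpha> p n s \<longrightarrow> minimax_risk \<alpha> K p n s \<rho> \<ge> 1 / 2)"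
      by (intro exI[of _ 16] exI[of _ "1 / 10 ^ 10"] conjI allI impI ballI main) simp_all
  qed simp
qed

end
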